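(* Let $N=pq$ be a product of two primes $p,q$, and let $k\ge1$ be an integer. Let $\ell_1,\ldots,\ell_n$ be distinct odd primes, each at least $L$ (where $L>0$), and none dividing $N$. Put $m=\ell_1\cdots\ell_n$. For each $i$, choose distinct coefficients $a_{i,1},\ldots,a_{i,k}\in\mathbb F_{\ell_i}^*$, and define $$V_m=\Bigl\{s\in\mathbb Z/m\mathbb Z:\ s\bmod\ell_i\in\bigcup_{j=1}^kH_{a_{i,j}}(N;\ell_i)\text{ for every }i\Bigr\}.$$ Then $$|V_m|\le m\prod_{i=1}^n\Bigl(1-2^{-k}+(k-1+2^{-k})\ell_i^{-1/2}+k\ell_i^{-1}\Bigr)\le m\Bigl(1-2^{-k}+(k-1+2^{-k})L^{-1/2}+kL^{-1}\Bigr)^n.$$ Moreover, for every tuple $(j_1,\ldots,j_n)\in\{1,\ldots,k\}^n$, let $a(j_1,\ldots,j_n)\in(\mathbb Z/m\mathbb Z)^*$ be the unique class with $a(j_1,\ldots,j_n)\equiv a_{i,j_i}\pmod{\ell_i}$ for every $i$. Then the residue of $a(j_1,\ldots,j_n)\,p+q$ modulo $m$ lies in $V_m$.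
   Context: For an odd prime $\ell$, an integer $N$ not divisible by $\ell$ (identified with its image in $\mathbb F_\ell^*$), and $a\in\mathbb F_\ell^*$, $H_a(N;\ell)=\{ax+Nx^{-1}:x\in\mathbb F_\ell^*\}\subseteq\mathbb F_\ell$. *)

theory Defs
  imports Complex_Main "HOL-Library.FuncSet" "HOL-Number_Theory.Residues"
begin

text \<open>
  The ring of integers modulo \<open>m\<close> is \<^term>\<open>residue_ring m\<close>, whose carrier consists of the
  representatives \<open>0, \<dots>, m - 1\<close>; an integer enters it through \<open>mod m\<close>.
\<close>

definition hyperbola_values :: "int \<Rightarrow> int \<Rightarrow> int \<Rightarrow> int set" where
  "hyperbola_values l N a =
     {(a \<otimes>\<^bsub>residue_ring l\<^esub> x) \<oplus>\<^bsub>residue_ring l\<^esub>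
        ((N mod l) \<otimes>\<^bsub>residue_ring l\<^esub> inv\<^bsub>residue_ring l\<^esub> x)
      | x. x \<in> Units (residue_ring l)}"

definition sieve_set ::
  "int \<Rightarrow> nat \<Rightarrow> nat \<Rightarrow> (nat \<Rightarrow> nat) \<Rightarrow> (nat \<Rightarrow> nat \<Rightarrow> int) \<Rightarrow> int set" where
  "sieve_set N k n l a =
     {s \<in> carrier (residue_ring (\<Prod>i=1..n. int (l i))).
        \<forall>i\<in>{1..n}. s mod int (l i) \<in> (\<Union>j\<in>{1..k}. hyperbola_values (int (l i)) N (a i j))}"

text \<open>
  The unit group of the integers modulo \<open>m\<close>. It agrees with \<open>Units (residue_ring m)\<close> for
  \<open>m > 1\<close>, but \<^term>\<open>residue_ring 1\<close> has the unit element \<open>1\<close> outside its carrier \<open>{0}\<close>, so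
  \<open>Units\<close> would be empty for the trivial ring (the empty product of moduli).
\<close>

definition unit_residues :: "int \<Rightarrow> int set" where
  "unit_residues m = {c \<in> carrier (residue_ring m). coprime c m}"

end

theory Submission
  imports Defs
    "HOL-Computational_Algebra.Polynomial_Factorial"
    "HOL-Computational_Algebra.Fundamental_Theorem_Algebra"
    "HOL-Computational_Algebra.Polynomial_FPS"
    "Berlekamp_Zassenhaus.Finite_Field"
begin

text \<open>
  Fix one prime \<open>l\<close> and write \<open>\<chi>\<close> for the quadratic character modulo \<open>l\<close>. If
  \<open>s = a x + N / x\<close>, then \<open>s\<^sup>2 - 4 a N = (a x - N / x)\<^sup>2\<close>. So a residue that lies in one of the \<open>k\<close>
  hyperbola sets makes one of the numbers \<open>s\<^sup>2 - c\<^sub>j\<close>, \<open>c\<^sub>j = 4 a\<^sub>j N\<close>, a square, and the sieve bound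
  amounts to finding many \<open>s\<close> for which all \<open>s\<^sup>2 - c\<^sub>j\<close> are nonsquares
  (\<open>card_all_nonsquares_ge\<close>). Up to the few zeros of \<open>s\<^sup>2 - c\<^sub>j\<close>, the product of the
  \<open>1 - \<chi>(s\<^sup>2 - c\<^sub>j)\<close> is \<open>2\<^sup>k\<close> times the indicator of this event. It expands into a sum over subsets
  \<open>T\<close> of \<open>{1..k}\<close>; the empty set gives the main term \<open>l\<close>, and a nonempty \<open>T\<close> gives the sum over \<open>s\<close>
  of the \<open>\<chi>\<close>-value of the product of the \<open>s\<^sup>2 - c\<^sub>j\<close> with \<open>j \<in> T\<close>, which is at most
  \<open>(2 |T| - 1) \<surd>l\<close> in absolute value. The average of \<open>2 |T| - 1\<close> over all \<open>T\<close>, corrected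
  for the empty set, is the constant \<open>k - 1 + 2\<^bsup>-k\<^esup>\<close>. The local bounds multiply because a
  residue modulo \<open>m\<close> is determined by its residues modulo the \<open>l\<^sub>i\<close>. The last claim is the
  case \<open>x = p\<close>, because \<open>q = N / p\<close>.

  The substance is Weil's bound (\<open>weil_bound\<close>): the values of \<open>\<chi>\<close> on a product of
  \<open>d\<close> distinct linear factors \<open>u - c\<close>, \<open>c \<in> C\<close>, sum to at most \<open>(d - 1) \<surd>l\<close>. The proof never leaves the
  polynomial ring over the prime field. Let \<open>\<psi>(f)\<close> be the product of the \<open>\<chi>(f(c))\<close>,
  which is multiplicative in \<open>f\<close>. Its sum over monic \<open>f\<close> of degree \<open>n\<close> is, for
  \<open>n = 1\<close>, the sum in question up to sign, and it vanishes for \<open>n \<ge> d\<close>. So the generating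
  series is a polynomial, with \<open>d - 1\<close> inverse roots \<open>\<omega>\<^sub>i\<close>. By unique factorization
  the power sums of the \<open>\<omega>\<^sub>i\<close> are, up to sign, sums of \<open>\<psi>\<close> over prime powers of fixed degree
  (\<open>log_derivative_identity\<close>). Power sums grow like the largest \<open>\<omega>\<^sub>i\<close>
  (\<open>norm_le_of_power_sums_bounded\<close>), so it suffices to bound these sums by a constant times
  \<open>l\<^sup>t\<close> when the degree is \<open>2 t\<close>. A reciprocity law in the style of Gauss's lemma
  (\<open>linear_power_cong_norm\<close>) identifies \<open>\<psi>(p)\<close> with the residue symbol modulo \<open>p\<close> of
  the product of the \<open>X - c\<close>, and for a prescribed residue symbol Stepanov's method in Bombieri's form
  (\<open>stepanov_bound\<close>) produces a nonzero polynomial of small degree that is divisible by every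
  prime polynomial with that symbol.

  The field with \<open>l\<close> elements is a type, while \<open>l\<close> is bound inside the statement. It is enough,
  however, to treat a single prime, namely a counterexample picked by Hilbert's choice operator in case there is one:
  this prime is a closed term, so that its residues form a type.
\<close>

section \<open>Quadratic characters on prime fields\<close>

class odd_prime_card = prime_card + assumes odd_card: "odd CARD('a)"

text \<open>
  Integer values keep the character sums in characteristic zero.
\<close>

definition quad_char :: "'a::field \<Rightarrow> int" where
  "quad_char x = (if x = 0 then 0 else if \<exists>y. x = y ^ 2 then 1 else - 1)"

lemma quad_char_0 [simp]: "quad_char 0 = 0"
  by (simp add: quad_char_def)

lemma quad_char_1 [simp]: "quad_char 1 = 1"
  unfolding quad_char_def by (metis one_power2 zero_neq_one)

lemma quad_char_eq_0_iff [simp]: "quad_char x = 0 \<longleftrightarrow> x = 0"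
  by (simp add: quad_char_def)

lemma quad_char_cases: "quad_char x \<in> {0, 1, -1}"
  by (simp add: quad_char_def)

lemma abs_quad_char_le_1: "\<bar>quad_char x\<bar> \<le> 1"
  by (simp add: quad_char_def)

lemma card_ge_3: "CARD('a::odd_prime_card) \<ge> 3"
proof -
  have "CARD('a) \<ge> 2"
    using prime_card[where 'a='a] prime_ge_2_nat by blast
  with odd_card[where 'a='a] show ?thesis
    by (cases "CARD('a) = 2") auto
qed

lemma half_card: "2 * ((CARD('a::odd_prime_card) - 1) div 2) = CARD('a) - 1"
  using odd_card[where 'a='a] by simp

lemma power_card_minus_1:
  fixes x :: "'a::prime_card mod_ring"
  assumes "x \<noteq> 0"
  shows "x ^ (CARD('a) - 1) = 1"
proof -
  have "x ^ Suc (CARD('a) - 1) = x"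
    using finite_field_power_card_eq_same[of x] zero_less_card_finite[where 'a='a] by simp
  hence "x * x ^ (CARD('a) - 1) = x" by (simp only: power_Suc)
  thus ?thesis using assms by simp
qed

lemma two_neq_0: "(2 :: 'a::odd_prime_card mod_ring) \<noteq> 0"
proof
  assume "(2 :: 'a mod_ring) = 0"
  hence "of_nat 2 = (0 :: 'a mod_ring)" by simp
  hence "CARD('a) dvd 2" by (rule of_nat_0_mod_ring_dvd)
  with card_ge_3[where 'a='a] show False
    by (auto dest: dvd_imp_le)
qed

lemma one_neq_minus_one: "(1 :: 'a::odd_prime_card mod_ring) \<noteq> - 1"
  using two_neq_0[where 'a='a] by (metis one_add_one add.right_inverse)

lemma neq_minus_self: "x \<noteq> 0 \<Longrightarrow> x \<noteq> - (x :: 'a::odd_prime_card mod_ring)"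
proof
  assume "x \<noteq> 0" "x = - x"
  hence "x + x = 0" by (metis add.right_inverse)
  hence "2 * x = 0" by simp
  with \<open>x \<noteq> 0\<close> two_neq_0 show False by auto
qed

lemma card_square_roots_of_square:
  fixes y :: "'a::odd_prime_card mod_ring"
  assumes "y \<noteq> 0"
  shows "card {z. z ^ 2 = y ^ 2} = 2"
proof -
  have "{z. z ^ 2 = y ^ 2} = {y, - y}"
    by (auto simp: power2_eq_iff)
  thus ?thesis
    using neq_minus_self[OF assms] by simp
qed

lemma card_roots_of_unity_le:
  fixes n :: nat
  assumes "n > 0"
  shows "card {x :: 'a::prime_card mod_ring. x ^ n = 1} \<le> n"
proof -
  define f :: "'a mod_ring poly" where "f = Polynomial.monom 1 n - 1"
  have deg: "degree f \<le> n"
    unfolding f_def by (rule degree_diff_le) (auto simp: Polynomial.degree_monom_eq)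
  have "Polynomial.coeff f n = 1"
    using assms unfolding f_def by simp
  hence "f \<noteq> 0" by auto
  hence "card {x. poly f x = 0} \<le> degree f"
    by (rule card_poly_roots_bound)
  also have "{x. poly f x = 0} = {x. x ^ n = 1}"
    by (auto simp: f_def poly_monom)
  finally show ?thesis using deg by simp
qed

text \<open>
  Squaring is two-to-one on the nonzero elements, which yields \<open>h = (q - 1) / 2\<close> squares. All of them are
  roots of \<open>X\<^sup>h - 1\<close>, and there is no room for further roots.
\<close>

lemma nonzero_squares:
  defines "h \<equiv> (CARD('a::odd_prime_card) - 1) div 2"
  shows "{x :: 'a mod_ring. \<exists>y. y \<noteq> 0 \<and> x = y ^ 2} = {x. x ^ h = 1}"
    and "card {x :: 'a mod_ring. \<exists>y. y \<noteq> 0 \<and> x = y ^ 2} = h"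
proof -
  let ?S = "{x :: 'a mod_ring. \<exists>y. y \<noteq> 0 \<and> x = y ^ 2}"
  have h: "2 * h = CARD('a) - 1"
    unfolding h_def by (rule half_card)
  have h0: "h > 0" using h card_ge_3[where 'a='a] by auto
  have "(\<Union>x\<in>?S. {z. z ^ 2 = x}) = - {0}"
    by auto
  moreover have "card (- {0 :: 'a mod_ring}) = CARD('a) - 1"
    by (simp add: Compl_eq_Diff_UNIV card_Diff_subset)
  moreover have "card (\<Union>x\<in>?S. {z. z ^ 2 = x}) = (\<Sum>x\<in>?S. card {z. z ^ 2 = x})"
    by (rule card_UN_disjoint) auto
  moreover have "(\<Sum>x\<in>?S. card {z. z ^ 2 = x}) = (\<Sum>x\<in>?S. 2)"
    by (rule sum.cong) (auto simp: card_square_roots_of_square)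
  ultimately show *: "card ?S = h"
    using h by simp
  have "?S \<subseteq> {x. x ^ h = 1}"
  proof
    fix x assume "x \<in> ?S"
    then obtain y where y: "y \<noteq> 0" "x = y ^ 2" by blast
    thus "x \<in> {x. x ^ h = 1}"
      using power_card_minus_1[of y] h by (simp flip: power_mult)
  qed
  moreover have "card {x :: 'a mod_ring. x ^ h = 1} \<le> h"
    by (rule card_roots_of_unity_le[OF h0])
  ultimately show "?S = {x. x ^ h = 1}"
    using * by (intro card_seteq) auto
qed

theorem quad_char_euler:
  fixes x :: "'a::odd_prime_card mod_ring"
  shows "of_int (quad_char x) = x ^ ((CARD('a) - 1) div 2)"
proof (cases "x = 0")
  case True
  thus ?thesis using half_card[where 'a='a] card_ge_3[where 'a='a] by (auto simp: power_0_left)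
next
  case False
  let ?h = "(CARD('a) - 1) div 2"
  have "(x ^ ?h) ^ 2 = 1"
    using power_card_minus_1[OF False] half_card[where 'a='a]
    by (simp flip: power_mult add: mult.commute)
  hence "x ^ ?h = 1 \<or> x ^ ?h = - 1"
    by (simp add: power2_eq_1_iff)
  moreover have "x \<in> {x. x ^ ?h = 1} \<longleftrightarrow> (\<exists>y. x = y ^ 2)"
    using False by (subst nonzero_squares(1)[symmetric]) auto
  ultimately show ?thesis
    using False by (auto simp: quad_char_def)
qed

text \<open>
  Identities between signs may be checked in the field, since \<open>0\<close>, \<open>1\<close> and \<open>-1\<close> stay distinct
  in odd characteristic.
\<close>

lemma of_int_sign_inject:
  assumes "of_int a = (of_int b :: 'a::odd_prime_card mod_ring)"
    and "a \<in> {0, 1, -1}" "b \<in> {0, 1, -1}"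
  shows "a = b"
  using assms one_neq_minus_one[where 'a='a] by (auto dest: sym)

lemma quad_char_mult:
  fixes x y :: "'a::odd_prime_card mod_ring"
  shows "quad_char (x * y) = quad_char x * quad_char y"
proof (rule of_int_sign_inject[where 'a='a])
  show "of_int (quad_char (x * y)) = (of_int (quad_char x * quad_char y) :: 'a mod_ring)"
    by (simp add: quad_char_euler power_mult_distrib)
  show "quad_char (x * y) \<in> {0, 1, -1}" by (rule quad_char_cases)
  show "quad_char x * quad_char y \<in> {0, 1, -1}"
    using quad_char_cases[of x] quad_char_cases[of y] by auto
qed

lemma quad_char_power:
  "quad_char (x ^ n :: 'a::odd_prime_card mod_ring) = quad_char x ^ n"
  by (induction n) (simp_all add: quad_char_mult)

lemma quad_char_inverse:
  "quad_char (inverse x :: 'a::odd_prime_card mod_ring) = quad_char x"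
proof (cases "x = 0")
  case False
  hence "quad_char x * quad_char (inverse x) = 1"
    by (simp flip: quad_char_mult)
  thus ?thesis using quad_char_cases[of x] by auto
qed simp

lemma quad_char_even_power:
  assumes "even n" "x \<noteq> 0"
  shows "quad_char x ^ n = 1"
  using quad_char_cases[of x] assms by auto

lemma exists_nonsquare: "\<exists>z :: 'a::odd_prime_card mod_ring. quad_char z = - 1"
proof (rule ccontr)
  assume *: "\<not> ?thesis"
  have "x \<in> {x :: 'a mod_ring. \<exists>y. y \<noteq> 0 \<and> x = y ^ 2}" if "x \<noteq> 0" for x
  proof -
    have "\<exists>y. x = y ^ 2"
      using * that by (metis quad_char_def)
    thus ?thesis using that by auto
  qed
  hence "- {0} \<subseteq> {x :: 'a mod_ring. \<exists>y. y \<noteq> 0 \<and> x = y ^ 2}"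
    by blast
  hence "card (- {0 :: 'a mod_ring}) \<le> (CARD('a) - 1) div 2"
    unfolding nonzero_squares(2)[where 'a='a, symmetric] by (rule card_mono[OF finite])
  moreover have "card (- {0 :: 'a mod_ring}) = CARD('a) - 1"
    by (simp add: Compl_eq_Diff_UNIV card_Diff_subset)
  ultimately show False
    using card_ge_3[where 'a='a] half_card[where 'a='a] by linarith
qed

lemma card_square_roots:
  fixes x :: "'a::odd_prime_card mod_ring"
  shows "int (card {y. y ^ 2 = x}) = 1 + quad_char x"
proof (cases "\<exists>y. x = y ^ 2")
  case True
  then obtain y where y: "x = y ^ 2" by blast
  show ?thesis
  proof (cases "y = 0")
    case True
    thus ?thesis using y by simp
  next
    case False
    thus ?thesis using y card_square_roots_of_square[OF False] by (auto simp: quad_char_def)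
  qed
next
  case False
  hence "{y. y ^ 2 = x} = {}" by auto
  moreover have "x \<noteq> 0" using False by (metis zero_power2)
  ultimately show ?thesis using False by (simp add: quad_char_def)
qed

section \<open>Stepanov's bound by an auxiliary polynomial\<close>

lemma finite_degree_less: "finite {p :: 'a::{finite,zero} poly. degree p < n}"
proof -
  have "{p :: 'a poly. degree p < n} \<subseteq> Poly ` {xs. length xs \<le> n \<and> set xs \<subseteq> UNIV}"
  proof
    fix p :: "'a poly" assume "p \<in> {p. degree p < n}"
    hence "length (coeffs p) \<le> n"
      by (cases "p = 0") (auto simp: length_coeffs)
    thus "p \<in> Poly ` {xs. length xs \<le> n \<and> set xs \<subseteq> UNIV}"
      by (intro image_eqI[of _ _ "coeffs p"]) auto
  qed
  moreover have "finite {xs :: 'a list. length xs \<le> n \<and> set xs \<subseteq> UNIV}"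
    using finite_lists_length_le[of "UNIV :: 'a set" n] by (simp add: conj_commute)
  ultimately show ?thesis using finite_subset by blast
qed

lemma card_degree_less:
  assumes "n > 0"
  shows "card {p :: 'a::{finite,zero} poly. degree p < n} = CARD('a) ^ n"
  using assms
proof (induction n rule: nat_induct_non_zero)
  case 1
  have "{p :: 'a poly. degree p < 1} = (\<lambda>a. [:a:]) ` UNIV"
    by (auto elim: degree_eq_zeroE)
  thus ?case by (simp add: card_image inj_on_def)
next
  case (Suc n)
  have "{p :: 'a poly. degree p < Suc n}
          = (\<lambda>(a, p). pCons a p) ` (UNIV \<times> {p. degree p < n})"
  proof (intro equalityI subsetI)
    fix p :: "'a poly" assume p: "p \<in> {p. degree p < Suc n}"
    obtain a r where ar: "p = pCons a r" by (cases p)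
    have "degree r < n"
      using p ar Suc.hyps by (cases "r = 0") auto
    thus "p \<in> (\<lambda>(a, p). pCons a p) ` (UNIV \<times> {p. degree p < n})"
      using ar by auto
  next
    fix p :: "'a poly"
    assume "p \<in> (\<lambda>(a, p). pCons a p) ` (UNIV \<times> {p. degree p < n})"
    thus "p \<in> {p. degree p < Suc n}"
      by (auto intro: le_less_trans[OF degree_pCons_le])
  qed
  moreover have "inj_on (\<lambda>(a, p). pCons a p) (UNIV \<times> {p :: 'a poly. degree p < n})"
    by (auto simp: inj_on_def)
  ultimately show ?case
    by (simp add: card_image card_cartesian_product Suc.IH)
qed

text \<open>
  The degrees of the summands lie in the disjoint windows \<open>[i P, (i + 1) P)\<close>, so nothing can cancel
  against the last nonzero digit. This is what makes the auxiliary polynomial in Stepanov's method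
  nonzero.
\<close>

lemma degree_digit_expansion:
  fixes a :: "nat \<Rightarrow> 'a::idom poly"
  assumes "\<And>i. i < m \<Longrightarrow> degree (a i) < P" and "\<exists>i<m. a i \<noteq> 0"
  shows "\<exists>i<m. a i \<noteq> 0 \<and> (\<Sum>i<m. Polynomial.monom 1 (i * P) * a i) \<noteq> 0 \<and>
           degree (\<Sum>i<m. Polynomial.monom 1 (i * P) * a i) = i * P + degree (a i)"
  using assms
proof (induction m)
  case (Suc m)
  let ?S = "\<Sum>i<m. Polynomial.monom 1 (i * P) * a i"
  show ?case
  proof (cases "a m = 0")
    case True
    hence "\<exists>i<m. a i \<noteq> 0" using Suc.prems(2) less_Suc_eq by auto
    thus ?thesis using Suc.IH Suc.prems(1) True by (auto simp: less_Suc_eq)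
  next
    case False
    have top: "degree (Polynomial.monom 1 (m * P) * a m) = m * P + degree (a m)"
      using False by (subst degree_mult_eq) (auto simp: Polynomial.degree_monom_eq monom_eq_0_iff)
    have "degree (?S + Polynomial.monom 1 (m * P) * a m) = m * P + degree (a m)
       \<and> ?S + Polynomial.monom 1 (m * P) * a m \<noteq> 0"
    proof (cases "m = 0")
      case True
      thus ?thesis using top False by (simp add: monom_eq_0_iff)
    next
      case m: False
      have P: "P > 0" using Suc.prems(1)[of m] by auto
      have "degree ?S < m * P"
      proof (rule degree_sum_less)
        fix i assume "i \<in> {..<m}"
        hence i: "i < m" by simp
        have "degree (Polynomial.monom 1 (i * P) * a i) \<le> i * P + degree (a i)"
          by (rule order_trans[OF degree_mult_le]) (simp add: Polynomial.degree_monom_le)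
        also have "\<dots> < i * P + P" using Suc.prems(1)[of i] i by simp
        also have "\<dots> \<le> m * P" using i by (metis add.commute mult_Suc mult_le_mono1 Suc_leI)
        finally show "degree (Polynomial.monom 1 (i * P) * a i) < m * P" .
      qed (use m P in auto)
      hence less: "degree ?S < degree (Polynomial.monom 1 (m * P) * a m)"
        using top by simp
      show ?thesis
        using degree_add_eq_right[OF less] top less by (metis degree_0 not_less_zero)
    qed
    thus ?thesis using False by auto
  qed
qed simp

lemma prod_primes_dvd:
  fixes f :: "'a::factorial_semiring_gcd"
  assumes "finite G" "\<And>p. p \<in> G \<Longrightarrow> prime p" "\<And>p. p \<in> G \<Longrightarrow> p dvd f"
  shows "\<Prod>G dvd f"
  using assms
proof (induction G rule: finite_induct)
  case (insert p G)
  have "coprime p (\<Prod>G)"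
    by (rule prod_coprime_right) (use insert in \<open>auto intro!: primes_coprime\<close>)
  thus ?case
    using insert by (simp add: divides_mult)
qed simp

lemma frobenius_poly_sum:
  fixes f :: "'b \<Rightarrow> 'a::prime_card mod_ring poly"
  shows "(\<Sum>i\<in>A. f i) ^ (CARD('a) ^ t) = (\<Sum>i\<in>A. f i ^ (CARD('a) ^ t))"
  by (rule freshmans_dream_sum'[of _ t]) (use prime_card[where 'a='a] in auto)

lemma frobenius_poly_add:
  fixes f g :: "'a::prime_card mod_ring poly"
  shows "(f + g) ^ (CARD('a) ^ t) = f ^ (CARD('a) ^ t) + g ^ (CARD('a) ^ t)"
  by (rule freshmans_dream'[of _ t]) (use prime_card[where 'a='a] in auto)

lemma frobenius_poly_diff:
  fixes f g :: "'a::prime_card mod_ring poly"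
  shows "(f - g) ^ (CARD('a) ^ t) = f ^ (CARD('a) ^ t) - g ^ (CARD('a) ^ t)"
  using frobenius_poly_add[of "f - g" g t] by (simp add: algebra_simps)

lemma prime_dvd_power_cong_0:
  fixes p :: "'a::{factorial_ring_gcd,unique_euclidean_ring}"
  assumes "prime p" "[f ^ n = 0] (mod p)"
  shows "p dvd f"
  using assms by (metis cong_0_iff prime_dvd_power)

text \<open>
  Let \<open>d = 2 g + 1\<close> and \<open>Q = P\<^sup>2\<close>. The auxiliary polynomial is
  \<open>\<Psi> = \<Sum>\<^sub>i X\<^bsup>i P\<^esup> (a\<^sub>i + b\<^sub>i f\<^bsup>(P + 1) / 2\<^esup>)\<close> with digits \<open>a\<^sub>i\<close>, \<open>b\<^sub>i\<close> of small degree. Raising to the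
  power \<open>P\<close> is additive, and modulo a prime \<open>p \<in> G\<close> one has \<open>X\<^sup>Q = X\<close> and
  \<open>f\<^bsup>(Q - 1) / 2\<^esup> = \<epsilon>\<close>. Hence \<open>\<Psi>\<^sup>P\<close> is congruent to
  \<open>\<Sum>\<^sub>i X\<^sup>i (a\<^sub>i\<^sup>P + \<epsilon> b\<^sub>i\<^sup>P f\<^bsup>(P + 1) / 2\<^esup>)\<close>, the same polynomial for all \<open>p\<close> and additive in the digits.
  Its degree is so small that, by the pigeonhole principle, some nonzero choice of digits makes it zero. Then every
  \<open>p \<in> G\<close> divides \<open>\<Psi>\<close>, and the degree of \<open>\<Psi>\<close> bounds the sum. That \<open>\<Psi>\<close> is not zero
  is seen from the parity of \<open>d\<close>. The half in \<open>Q / 2\<close> comes from the factor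
  \<open>f\<^bsup>(P + 1) / 2\<^esup>\<close>, which doubles the number of digits without raising the degree of \<open>\<Psi>\<close> much.
\<close>

theorem stepanov_bound:
  fixes f :: "'a::odd_prime_card mod_ring poly" and \<epsilon> :: "'a mod_ring"
  assumes deg_f: "degree f = 2 * g + 1"
    and P: "P = CARD('a) ^ t" "P = 2 * h + 1" and h: "h \<ge> 2 * g + 2"
    and G: "finite G" "\<And>p. p \<in> G \<Longrightarrow> prime p"
    and frob: "\<And>p. p \<in> G \<Longrightarrow> [Polynomial.monom 1 (P ^ 2) = Polynomial.monom 1 1] (mod p)"
    and euler: "\<And>p. p \<in> G \<Longrightarrow> [f ^ ((P ^ 2 - 1) div 2) = [:\<epsilon>:]] (mod p)"
  shows "2 * (\<Sum>p\<in>G. degree p) \<le> P ^ 2 + 4 * (2 * g + 1) * P"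
proof -
  define d where "d = 2 * g + 1"
  \<comment> \<open>\<open>D\<close> is the largest digit length that keeps the parity argument below valid; \<open>I\<close> is about
    \<open>P / 2\<close>, with enough excess to leave more digits than equations.\<close>
  define I where "I = h + d"
  define D where "D = h - g"
  define Z where "Z = I + (D - 1) * P + d * (h + 1)"
  define W where "W = {w :: 'a mod_ring poly. degree w < D}"
  define E where "E = (\<lambda>a b. \<Sum>i<I. Polynomial.monom 1 i * (a i ^ P + smult \<epsilon> (b i ^ P * f ^ (h + 1))) :: 'a mod_ring poly)"
  define Psi where "Psi = (\<lambda>a b. \<Sum>i<I. Polynomial.monom 1 (i * P) * (a i + b i * f ^ (h + 1)) :: 'a mod_ring poly)"
  have D: "D > 0" "2 * (D - 1) + d < P" "2 * (D - 1) < P"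
    using h P(2) by (auto simp: D_def d_def)
  have f0: "f \<noteq> 0" using deg_f by auto
  have deg_fpow: "degree (f ^ (h + 1)) = d * (h + 1)"
    unfolding degree_power_eq[OF f0] deg_f d_def by (rule refl)
  \<comment> \<open>There are \<open>2 D I\<close> free coefficients against \<open>Z\<close> equations.\<close>
  have count: "Z < 2 * (D * I)"
  proof -
    obtain e where e: "h = 2 * g + 2 + e" using h le_Suc_ex by blast
    have "D = g + 2 + e" "D - 1 = g + 1 + e" using e by (auto simp: D_def)
    thus ?thesis
      unfolding Z_def I_def d_def P(2) by (simp add: e algebra_simps)
  qed

  have E_diff: "E (\<lambda>i. a i - a' i) (\<lambda>i. b i - b' i) = E a b - E a' b'" for a a' b b'
    unfolding E_def P(1)
    by (simp add: frobenius_poly_diff algebra_simps sum_subtractf smult_diff_right sum.distrib)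

  have E_deg: "degree (E a b) < Z" if ab: "\<And>i. i < I \<Longrightarrow> a i \<in> W" "\<And>i. i < I \<Longrightarrow> b i \<in> W" for a b
    unfolding E_def
  proof (rule degree_sum_less)
    fix i assume "i \<in> {..<I}"
    hence i: "i < I" by simp
    have pw: "degree (w ^ P) \<le> (D - 1) * P" if "w \<in> W" for w
      using that degree_power_le[of w P] by (intro order_trans[OF degree_power_le]) (auto simp: W_def)
    have 1: "degree (a i ^ P) \<le> (D - 1) * P + d * (h + 1)"
      using pw[OF ab(1)[OF i]] by simp
    have "degree (smult \<epsilon> (b i ^ P * f ^ (h + 1))) \<le> degree (b i ^ P * f ^ (h + 1))"
      by (rule degree_smult_le)
    also have "\<dots> \<le> degree (b i ^ P) + degree (f ^ (h + 1))"
      by (rule degree_mult_le)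
    also have "\<dots> \<le> (D - 1) * P + d * (h + 1)"
      using pw[OF ab(2)[OF i]] deg_fpow by simp
    finally have 2: "degree (smult \<epsilon> (b i ^ P * f ^ (h + 1))) \<le> (D - 1) * P + d * (h + 1)" .
    have "degree (Polynomial.monom 1 i * (a i ^ P + smult \<epsilon> (b i ^ P * f ^ (h + 1))))
        \<le> i + ((D - 1) * P + d * (h + 1))"
      by (intro order_trans[OF degree_mult_le] add_mono degree_add_le 1 2 Polynomial.degree_monom_le)
    also have "\<dots> < Z" using i by (simp add: Z_def)
    finally show "degree (Polynomial.monom 1 i * (a i ^ P + smult \<epsilon> (b i ^ P * f ^ (h + 1)))) < Z" .
  qed (use h in \<open>auto simp: Z_def I_def\<close>)

  have "\<exists>a b. (\<forall>i<I. a i \<in> W) \<and> (\<forall>i<I. b i \<in> W) \<and> (\<exists>i<I. a i \<noteq> 0 \<or> b i \<noteq> 0) \<and> E a b = 0"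
  proof -
    let ?X = "({..<I} \<rightarrow>\<^sub>E W) \<times> ({..<I} \<rightarrow>\<^sub>E W)"
    have "card ?X = CARD('a) ^ (2 * (D * I))"
      using D(1) by (simp add: card_cartesian_product card_PiE W_def card_degree_less
          flip: power_mult power_add mult_2)
    moreover have "card ((\<lambda>(a, b). E a b) ` ?X) \<le> card {p :: 'a mod_ring poly. degree p < Z}"
      by (intro card_mono finite_degree_less) (auto intro!: E_deg simp: PiE_iff)
    moreover have "card {p :: 'a mod_ring poly. degree p < Z} = CARD('a) ^ Z"
      by (subst card_degree_less) (use h in \<open>auto simp: Z_def I_def\<close>)
    moreover have "CARD('a) ^ Z < CARD('a) ^ (2 * (D * I))"
      using count card_ge_3[where 'a='a] by (intro power_strict_increasing) auto
    ultimately have "\<not> inj_on (\<lambda>(a, b). E a b) ?X"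
      by (intro pigeonhole) linarith
    then obtain a b a' b' where *: "a \<in> {..<I} \<rightarrow>\<^sub>E W" "b \<in> {..<I} \<rightarrow>\<^sub>E W"
      "a' \<in> {..<I} \<rightarrow>\<^sub>E W" "b' \<in> {..<I} \<rightarrow>\<^sub>E W" "E a b = E a' b'" "(a, b) \<noteq> (a', b')"
      by (auto simp: inj_on_def)
    have Wd: "w - w' \<in> W" if "w \<in> W" "w' \<in> W" for w w'
      using that by (auto simp: W_def degree_diff_less)
    have "\<exists>i<I. a i \<noteq> a' i \<or> b i \<noteq> b' i"
      using * PiE_ext[OF *(1) *(3)] PiE_ext[OF *(2) *(4)] by blast
    thus ?thesis
      using * Wd by (intro exI[of _ "\<lambda>i. a i - a' i"] exI[of _ "\<lambda>i. b i - b' i"])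
        (auto simp: E_diff PiE_iff)
  qed
  then obtain a b where ab: "\<And>i. i < I \<Longrightarrow> a i \<in> W" "\<And>i. i < I \<Longrightarrow> b i \<in> W"
    "\<exists>i<I. a i \<noteq> 0 \<or> b i \<noteq> 0" and Eab: "E a b = 0"
    by blast

  have nz: "Psi a b \<noteq> 0"
  proof
    assume "Psi a b = 0"
    define A where "A = (\<Sum>i<I. Polynomial.monom 1 (i * P) * a i)"
    define B where "B = (\<Sum>i<I. Polynomial.monom 1 (i * P) * b i)"
    have "Psi a b = A + B * f ^ (h + 1)"
      unfolding Psi_def A_def B_def sum_distrib_right
      by (simp add: algebra_simps sum.distrib)
    with \<open>Psi a b = 0\<close> have A_eq: "A = - (B * f ^ (h + 1))"
      by (simp add: eq_neg_iff_add_eq_0)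
    have degs: "degree (a i) < P" "degree (b i) < P" if "i < I" for i
      using ab(1,2)[OF that] D by (auto simp: W_def)
    show False
    proof (cases "\<exists>i<I. b i \<noteq> 0")
      case True
      from degree_digit_expansion[of I b P, OF degs(2) this]
      obtain j where j: "j < I" "B \<noteq> 0" "degree B = j * P + degree (b j)"
        by (auto simp: B_def)
      hence "A \<noteq> 0" using A_eq f0 by simp
      moreover have "A = 0" if "\<not> (\<exists>i<I. a i \<noteq> 0)"
        unfolding A_def by (rule sum.neutral) (use that in auto)
      ultimately have "\<exists>i<I. a i \<noteq> 0" by blast
      from degree_digit_expansion[of I a P, OF degs(1) this]
      obtain i where i: "i < I" "degree A = i * P + degree (a i)"
        by (auto simp: A_def)
      have "degree A = degree B + d * (h + 1)"
        unfolding A_eq using j(2) f0 deg_fpow by (simp add: degree_mult_eq del: power_Suc)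
      hence "2 * (i * P + degree (a i)) = 2 * (j * P + degree (b j)) + d * (P + 1)"
        using i(2) j(3) P(2) by simp
      hence "2 * degree (a i) + (2 * i) * P = (2 * degree (b j) + d) + (2 * j + d) * P"
        by (simp add: algebra_simps)
      \<comment> \<open>Both low parts are smaller than \<open>P\<close>, hence equal; but only one of them is even.\<close>
      hence "(2 * degree (a i) + (2 * i) * P) mod P = ((2 * degree (b j) + d) + (2 * j + d) * P) mod P"
        by (rule arg_cong)
      moreover have "2 * degree (a i) < P"
        using ab(1)[OF i(1)] D by (auto simp: W_def)
      moreover have "2 * degree (b j) + d < P"
        using ab(2)[OF j(1)] D by (auto simp: W_def)
      ultimately have "2 * degree (a i) = 2 * degree (b j) + d"
        by simp
      hence "even (2 * degree (b j) + d)" by (metis dvd_triv_left)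
      thus False by (simp add: d_def)
    next
      case False
      hence "B = 0" unfolding B_def by (auto intro: sum.neutral)
      hence "A = 0" using A_eq by simp
      moreover obtain i where "i < I" "a i \<noteq> 0 \<or> b i \<noteq> 0" using ab(3) by auto
      hence "\<exists>i<I. a i \<noteq> 0" using False by auto
      ultimately show False
        using degree_digit_expansion[of I a P, OF degs(1)] by (auto simp: A_def)
    qed
  qed

  have dvd: "p dvd Psi a b" if p: "p \<in> G" for p
  proof (rule prime_dvd_power_cong_0[OF G(2)[OF p]])
    \<comment> \<open>The \<open>P\<close>-th power of \<open>f\<^bsup>(P + 1) / 2\<^esup>\<close> splits off the Euler factor \<open>f\<^bsup>(P\<^sup>2 - 1) / 2\<^esup>\<close>.\<close>
    have expo: "(h + 1) * P = (P ^ 2 - 1) div 2 + (h + 1)"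
      unfolding P(2) by (simp add: power2_eq_square algebra_simps)
    have Psi_pow: "Psi a b ^ P = (\<Sum>i<I. Polynomial.monom 1 (P ^ 2) ^ i *
        (a i ^ P + b i ^ P * (f ^ ((P ^ 2 - 1) div 2) * f ^ (h + 1))))"
      unfolding Psi_def P(1) frobenius_poly_sum power_mult_distrib frobenius_poly_add
      unfolding P(1)[symmetric] power_mult[symmetric] expo power_add[symmetric]
      by (simp add: monom_power power2_eq_square mult_ac)
    have "[Psi a b ^ P = (\<Sum>i<I. Polynomial.monom 1 1 ^ i *
        (a i ^ P + b i ^ P * ([:\<epsilon>:] * f ^ (h + 1))))] (mod p)"
      unfolding Psi_pow
      by (intro cong_sum cong_mult cong_add cong_pow cong_refl frob[OF p] euler[OF p])
    also have "(\<Sum>i<I. Polynomial.monom 1 1 ^ i * (a i ^ P + b i ^ P * ([:\<epsilon>:] * f ^ (h + 1)))) = E a b"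
      unfolding E_def by (simp add: monom_power mult_ac)
    finally show "[Psi a b ^ P = 0] (mod p)" using Eab by simp
  qed
  have "\<Prod>G dvd Psi a b"
    by (rule prod_primes_dvd) (use G dvd in auto)
  hence "degree (\<Prod>G) \<le> degree (Psi a b)"
    using nz by (rule dvd_imp_degree_le)
  also have "degree (\<Prod>G) = (\<Sum>p\<in>G. degree p)"
  proof (rule degree_prod_eq_sum_degree)
    show "\<forall>p\<in>G. p \<noteq> 0" using G(2) not_prime_0 by metis
  qed
  also have "degree (Psi a b) \<le> (I - 1) * P + (D - 1 + d * (h + 1))"
    unfolding Psi_def
  proof (rule degree_sum_le)
    fix i assume "i \<in> {..<I}"
    hence i: "i < I" by simp
    have "degree (b i * f ^ (h + 1)) \<le> D - 1 + d * (h + 1)"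
      by (rule order_trans[OF degree_mult_le])
        (use ab(2)[OF i] deg_fpow in \<open>auto simp: W_def\<close>)
    moreover have "degree (a i) \<le> D - 1 + d * (h + 1)"
      using ab(1)[OF i] by (auto simp: W_def)
    ultimately have "degree (a i + b i * f ^ (h + 1)) \<le> D - 1 + d * (h + 1)"
      by (intro degree_add_le)
    moreover have "degree (Polynomial.monom (1 :: 'a mod_ring) (i * P)) \<le> (I - 1) * P"
      using i by (intro order_trans[OF Polynomial.degree_monom_le]) auto
    ultimately show "degree (Polynomial.monom 1 (i * P) * (a i + b i * f ^ (h + 1)))
        \<le> (I - 1) * P + (D - 1 + d * (h + 1))"
      by (intro order_trans[OF degree_mult_le] add_mono)
  qed simp
  finally have "2 * (\<Sum>p\<in>G. degree p) \<le> 2 * ((I - 1) * P + (D - 1 + d * (h + 1)))"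
    by simp
  also have "\<dots> \<le> P ^ 2 + 4 * (2 * g + 1) * P"
  proof -
    obtain e where e: "h = 2 * g + 2 + e" using h le_Suc_ex by blast
    have "D - 1 = g + 1 + e" "I - 1 = 4 * g + 2 + e" using e by (auto simp: D_def I_def d_def)
    thus ?thesis
      unfolding d_def P(2) by (simp add: e power2_eq_square algebra_simps)
  qed
  finally show ?thesis .
qed

section \<open>Monic polynomials and products of leading coefficients\<close>

definition monics :: "nat \<Rightarrow> 'a::comm_semiring_1 poly set" where
  "monics n = {f. degree f = n \<and> lead_coeff f = 1}"

lemma finite_monics: "finite (monics n :: 'a::{finite,comm_semiring_1} poly set)"
  by (rule finite_subset[OF _ finite_degree_less[of "Suc n"]]) (auto simp: monics_def)

lemma monics_0: "monics 0 = {1}"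
  by (auto simp: monics_def elim!: degree_eq_zeroE)

lemma monics_nonzero: "f \<in> monics n \<Longrightarrow> f \<noteq> 0"
  by (auto simp: monics_def)

lemma card_monics:
  "card (monics n :: 'a::{finite,comm_ring_1} poly set) = CARD('a) ^ n"
proof (cases "n = 0")
  case True
  thus ?thesis by (simp add: monics_0)
next
  case False
  have "bij_betw (\<lambda>g. Polynomial.monom 1 n + g) {g :: 'a poly. degree g < n} (monics n)"
  proof (rule bij_betwI[where g = "\<lambda>f. f - Polynomial.monom 1 n"])
    show "(\<lambda>g. Polynomial.monom 1 n + g) \<in> {g :: 'a poly. degree g < n} \<rightarrow> monics n"
      by (auto simp: monics_def degree_add_eq_left Polynomial.degree_monom_eq coeff_eq_0)
    show "(\<lambda>f. f - Polynomial.monom 1 n) \<in> monics n \<rightarrow> {g :: 'a poly. degree g < n}"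
    proof safe
      fix f :: "'a poly" assume f: "f \<in> monics n"
      have "degree (f - Polynomial.monom 1 n) \<le> n"
        using f by (intro degree_diff_le) (auto simp: monics_def Polynomial.degree_monom_le)
      moreover have "Polynomial.coeff (f - Polynomial.monom 1 n) n = 0"
        using f by (auto simp: monics_def)
      ultimately show "degree (f - Polynomial.monom 1 n) < n"
        using False by (metis eq_zero_or_degree_less degree_0 neq0_conv)
    qed
  qed auto
  from bij_betw_same_card[OF this] show ?thesis
    using False by (simp add: card_degree_less)
qed

lemma prime_poly_monic:
  fixes p :: "'a::{field_gcd} poly"
  assumes "prime p"
  shows "lead_coeff p = 1" "degree p > 0" "irreducible p" "p \<noteq> 0"
proof -
  show p0: "p \<noteq> 0" using assms by auto
  have "normalize p = p" using assms by (rule normalize_prime)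
  hence "Polynomial.coeff (map_poly (\<lambda>x. x / lead_coeff p) p) (degree p) = lead_coeff p"
    using p0 by (simp add: normalize_poly_eq_map_poly)
  thus "lead_coeff p = 1" using p0 by (simp add: coeff_map_poly)
  show "irreducible p" using assms by (simp add: prime_elem_imp_irreducible)
  show "degree p > 0"
    using assms p0 by (metis is_unit_iff_degree neq0_conv not_prime_unit)
qed

text \<open>
  Wilson's theorem: \<open>X\<^bsup>q - 1\<^esup> - 1\<close> is the product of the \<open>X - a\<close> over nonzero \<open>a\<close>, because the difference has
  \<open>q - 1\<close> roots and smaller degree. Evaluating at \<open>0\<close> gives the claim.
\<close>

lemma prod_nonzero_eq_minus_1:
  "(\<Prod>x\<in>-{0 :: 'a::odd_prime_card mod_ring}. x) = - 1"
proof -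
  let ?q = "CARD('a)"
  define f :: "'a mod_ring poly" where
    "f = Polynomial.monom 1 (?q - 1) - 1 - (\<Prod>a\<in>-{0}. [:- a, 1:])"
  have q: "?q - 1 > 0" using card_ge_3[where 'a='a] by simp
  have card: "card (-{0 :: 'a mod_ring}) = ?q - 1"
    by (simp add: Compl_eq_Diff_UNIV card_Diff_subset)
  have degp: "degree (\<Prod>a\<in>-{0 :: 'a mod_ring}. [:- a, 1:]) = ?q - 1"
    by (subst degree_prod_eq_sum_degree) (auto simp: card)
  have lcp: "lead_coeff (\<Prod>a\<in>-{0 :: 'a mod_ring}. [:- a, 1:]) = 1"
    by (simp add: lead_coeff_prod)
  have "f = 0"
  proof (rule ccontr)
    assume f0: "f \<noteq> 0"
    have "degree f \<le> ?q - 1"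
      unfolding f_def using degp
      by (intro degree_diff_le) (auto simp: Polynomial.degree_monom_le)
    moreover have "Polynomial.coeff f (?q - 1) = 0"
      unfolding f_def using lcp degp q by simp
    ultimately have "degree f < ?q - 1"
      using f0 by (metis leading_coeff_0_iff nat_less_le)
    moreover have "card (-{0 :: 'a mod_ring}) \<le> card {x. poly f x = 0}"
    proof (intro card_mono)
      have "poly f x = 0" if "x \<noteq> 0" for x
      proof -
        have "(\<Prod>a\<in>-{0}. x - a) = 0"
          by (rule prod_zero) (use that in auto)
        thus ?thesis
          using power_card_minus_1[OF that] by (simp add: f_def poly_monom poly_prod)
      qed
      thus "-{0} \<subseteq> {x. poly f x = 0}" by auto
    qed auto
    moreover have "card {x. poly f x = 0} \<le> degree f"
      by (rule card_poly_roots_bound[OF f0])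
    ultimately show False using card by simp
  qed
  hence "poly f 0 = 0" by simp
  hence "(\<Prod>a\<in>-{0 :: 'a mod_ring}. - a) = - 1"
    using q by (simp add: f_def poly_monom poly_prod power_0_left)
  moreover have "(\<Prod>a\<in>-{0 :: 'a mod_ring}. - a) = (\<Prod>a\<in>-{0 :: 'a mod_ring}. a)"
    using odd_card[where 'a='a] card by (simp add: prod_uminus)
  ultimately show ?thesis by simp
qed

text \<open>
  By induction on the degree bound. The polynomials of exact degree \<open>e + 1\<close> with value \<open>b\<close> at \<open>c\<close> are
  the \<open>b + (X - c) \<alpha> m\<close> with \<open>\<alpha> \<noteq> 0\<close> and \<open>m\<close> monic of degree \<open>e\<close>. So every leading
  coefficient \<open>\<alpha>\<close> occurs \<open>q\<^sup>e\<close> times, an odd number, and Wilson's theorem contributes a factor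
  \<open>-1\<close>.
\<close>

lemma prod_lead_coeffs_fixed_value:
  fixes b c :: "'a::odd_prime_card mod_ring"
  assumes "b \<noteq> 0"
  shows "(\<Prod>f\<in>{f. degree f < Suc e \<and> poly f c = b}. lead_coeff f) = (- 1) ^ e * b"
proof (induction e)
  case 0
  have "{f. degree f < Suc 0 \<and> poly f c = b} = {[:b:]}"
    by (auto elim!: degree_eq_zeroE)
  thus ?case by simp
next
  case (Suc e)
  let ?N = "{f. degree f = Suc e \<and> poly f c = b}"
  have "{f. degree f < Suc (Suc e) \<and> poly f c = b}
      = {f. degree f < Suc e \<and> poly f c = b} \<union> ?N"
    by auto
  moreover have fin: "finite {f. degree f < Suc e \<and> poly f c = b}" "finite ?N"
    by (rule finite_subset[OF _ finite_degree_less[of "Suc (Suc e)"]]; auto)+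
  ultimately have "(\<Prod>f\<in>{f. degree f < Suc (Suc e) \<and> poly f c = b}. lead_coeff f)
      = (- 1) ^ e * b * (\<Prod>f\<in>?N. lead_coeff f)"
    by (simp only: Suc.IH[symmetric]) (rule prod.union_disjoint, auto)
  also have "(\<Prod>f\<in>?N. lead_coeff f)
     = (\<Prod>(\<alpha>, m)\<in>(-{0 :: 'a mod_ring}) \<times> (monics e :: 'a mod_ring poly set). \<alpha>)"
  proof (rule prod.reindex_bij_witness[where
        i = "\<lambda>(\<alpha>, m). [:b:] + [:- c, 1:] * smult \<alpha> m" and
        j = "\<lambda>f. (lead_coeff f, smult (inverse (lead_coeff f)) ((f - [:b:]) div [:- c, 1:]))"])
    fix f assume f: "f \<in> ?N"
    have "[:- c, 1:] dvd f - [:b:]"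
      using f by (simp add: poly_eq_0_iff_dvd[symmetric])
    then obtain k where k: "f - [:b:] = [:- c, 1:] * k" by (rule dvdE)
    have div_k: "(f - [:b:]) div [:- c, 1:] = k"
      unfolding k by (rule nonzero_mult_div_cancel_left) simp
    have "degree (f + [:- b:]) = Suc e"
      using f degree_add_eq_left[of "[:- b:]" f] by simp
    hence deg_fb: "degree (f - [:b:]) = Suc e" by (simp add: diff_conv_add_uminus del: add_uminus_conv_diff)
    hence k0: "k \<noteq> 0" using k by auto
    have "degree ([:- c, 1:] * k) = Suc (degree k)"
      using k0 by (subst degree_mult_eq) auto
    hence dk: "degree k = e"
      using deg_fb unfolding k by simp
    have "lead_coeff f = lead_coeff (f - [:b:])"
      using f unfolding deg_fb by simp
    also have "\<dots> = lead_coeff k"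
      unfolding k lead_coeff_mult by simp
    finally have lk: "lead_coeff k = lead_coeff f" by simp
    have lf: "lead_coeff f \<noteq> 0" using k0 lk by (metis leading_coeff_0_iff)
    have "[:b:] + [:- c, 1:] * k = f"
      unfolding k[symmetric] by simp
    thus "(case (lead_coeff f, smult (inverse (lead_coeff f)) ((f - [:b:]) div [:- c, 1:])) of
        (\<alpha>, m) \<Rightarrow> [:b:] + [:- c, 1:] * smult \<alpha> m) = f"
      unfolding div_k prod.case using lf by (simp del: mult_pCons_left)
    show "(lead_coeff f, smult (inverse (lead_coeff f)) ((f - [:b:]) div [:- c, 1:])) \<in> (-{0}) \<times> monics e"
      unfolding div_k using lf dk lk by (simp add: monics_def)
  next
    fix x assume x: "x \<in> (-{0 :: 'a mod_ring}) \<times> (monics e :: 'a mod_ring poly set)"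
    obtain \<alpha> m where xa: "x = (\<alpha>, m)" by (cases x)
    with x have \<alpha>: "\<alpha> \<noteq> 0" and m: "degree m = e" "lead_coeff m = 1" "m \<noteq> 0"
      by (auto simp: monics_def)
    let ?f = "[:b:] + [:- c, 1:] * smult \<alpha> m"
    have d: "degree ([:- c, 1:] * smult \<alpha> m) = Suc e"
      using \<alpha> m by (subst degree_mult_eq) auto
    have df: "degree ?f = Suc e"
      using d by (subst degree_add_eq_right) auto
    have "lead_coeff ?f = lead_coeff ([:- c, 1:] * smult \<alpha> m)"
      unfolding df d by simp
    also have "\<dots> = \<alpha>" unfolding lead_coeff_mult using m by simp
    finally have lf: "lead_coeff ?f = \<alpha>" .
    have dv: "(?f - [:b:]) div [:- c, 1:] = smult \<alpha> m"
      unfolding add_diff_cancel_left' by (rule nonzero_mult_div_cancel_left) simp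
    show "(\<lambda>f. (lead_coeff f, smult (inverse (lead_coeff f)) ((f - [:b:]) div [:- c, 1:])))
        ((\<lambda>(\<alpha>, m). [:b:] + [:- c, 1:] * smult \<alpha> m) x) = x"
      unfolding xa prod.case lf dv using \<alpha> by simp
    show "(\<lambda>(\<alpha>, m). [:b:] + [:- c, 1:] * smult \<alpha> m) x \<in> ?N"
      unfolding xa prod.case using df by (simp del: mult_pCons_left)
  qed auto
  also have "\<dots> = (\<Prod>\<alpha>\<in>-{0 :: 'a mod_ring}. \<alpha>) ^ card (monics e :: 'a mod_ring poly set)"
    by (simp add: prod.cartesian_product[symmetric] prod_power_distrib)
  also have "\<dots> = - 1"
    using odd_card[where 'a='a] by (simp add: prod_nonzero_eq_minus_1 card_monics)
  finally show ?case by simp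
qed

section \<open>Quadratic residue symbols modulo prime polynomials\<close>

lemma mod_poly_eq_diff_monic:
  fixes f p :: "'a::field poly"
  assumes "degree f = degree p" "lead_coeff f = 1" "lead_coeff p = 1"
    "degree p > 0"
  shows "f mod p = f - p" "degree (f - p) < degree p"
proof -
  have "degree (f - p) \<le> degree p"
    using assms by (intro degree_diff_le) auto
  moreover have "Polynomial.coeff (f - p) (degree p) = 0"
    using assms by simp
  ultimately show *: "degree (f - p) < degree p"
    using assms(4) by (metis eq_zero_or_degree_less degree_0)
  have "f mod p = (f - p) mod p" by simp
  also have "\<dots> = f - p" using * by (rule mod_poly_less)
  finally show "f mod p = f - p" .
qed

lemma prime_poly_dvd_linear_iff:
  fixes p :: "'a::field_gcd poly"
  assumes "prime p"
  shows "p dvd [:- c, 1:] \<longleftrightarrow> poly p c = 0"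
proof
  assume "p dvd [:- c, 1:]"
  then obtain r where r: "[:- c, 1:] = p * r" by (rule dvdE)
  have p: "degree p > 0" "p \<noteq> 0" using prime_poly_monic[OF assms] by auto
  have r0: "r \<noteq> 0" using r by auto
  have "degree [:- c, 1:] = degree p + degree r"
    unfolding r using p r0 by (intro degree_mult_eq)
  hence "degree r = 0" using p by simp
  then obtain u where u: "r = [:u:]" by (auto elim: degree_eq_zeroE)
  have "poly [:- c, 1:] c = poly p c * poly r c" unfolding r by (rule poly_mult)
  thus "poly p c = 0" using u r0 by simp
next
  assume "poly p c = 0"
  hence "[:- c, 1:] dvd p" by (simp add: poly_eq_0_iff_dvd)
  then obtain r where r: "p = [:- c, 1:] * r" by (rule dvdE)
  have "\<not> is_unit [:- c, 1:]" by (simp add: is_unit_iff_degree)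
  hence "is_unit r" using irreducibleD[OF prime_poly_monic(3)[OF assms] r] by blast
  thus "p dvd [:- c, 1:]" unfolding r by (rule mult_unit_dvd_iff[THEN iffD2]) simp
qed

text \<open>
  The exponent is \<open>(q\<^sup>e - 1) / (q - 1)\<close>, so the left side represents the norm of \<open>X - c\<close> from the residue field of \<open>p\<close>
  down to the prime field. The monic polynomials of degree below \<open>e\<close> represent the nonzero
  residue classes up to constants, and multiplication by \<open>X - c\<close> permutes them up to constants; as in Gauss's lemma,
  the product of these constants is the wanted power. A constant other than \<open>1\<close> can only
  come from some \<open>h\<close> of degree \<open>e - 1\<close>, whose product with \<open>X - c\<close> reduces to
  \<open>(X - c) h - p\<close>. These remainders are all the polynomials of degree below \<open>e\<close> with value
  \<open>- p(c)\<close> at \<open>c\<close>.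
\<close>

theorem linear_power_cong_norm:
  fixes p :: "'a::odd_prime_card mod_ring poly"
  assumes p: "prime p"
  defines "e \<equiv> degree p"
  shows "[[:- c, 1:] ^ (\<Sum>i<e. CARD('a) ^ i) = [:(- 1) ^ e * poly p c:]] (mod p)"
proof (cases "poly p c = 0")
  case True
  have "p dvd [:- c, 1:]" using True prime_poly_dvd_linear_iff[OF p] by blast
  moreover have "e > 0" using prime_poly_monic(2)[OF p] by (simp add: e_def)
  hence "(\<Sum>i<e. CARD('a) ^ i) > 0" by (intro sum_pos) auto
  ultimately have "p dvd [:- c, 1:] ^ (\<Sum>i<e. CARD('a) ^ i)"
    by (meson dvd_trans dvd_power)
  thus ?thesis using True by (simp add: cong_0_iff del: mult_pCons_left)
next
  case False
  define X where "X = [:- c, 1:]"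
  define H :: "'a mod_ring poly set" where "H = {h. degree h < e \<and> lead_coeff h = 1}"
  define s where "s = (\<lambda>h. lead_coeff ((X * h) mod p))"
  define T where "T = (\<lambda>h. smult (inverse (s h)) ((X * h) mod p))"
  note pm = prime_poly_monic[OF p]
  have p_elem: "prime_elem p" using p by simp
  obtain e' where e': "e = Suc e'" using pm(2) by (metis e_def gr0_implies_Suc)
  have finH: "finite H"
    by (rule finite_subset[OF _ finite_degree_less[of e]]) (auto simp: H_def)
  have H_split: "H = (\<Union>i<e. monics i)"
    by (auto simp: H_def monics_def)
  have cardH: "card H = (\<Sum>i<e. CARD('a) ^ i)"
    unfolding H_split by (subst card_UN_disjoint) (auto simp: finite_monics card_monics, auto simp: monics_def)
  have pX: "\<not> p dvd X" using False prime_poly_dvd_linear_iff[OF p] by (simp add: X_def)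
  have not_dvd_small: "\<not> p dvd h" if "degree h < e" "h \<noteq> 0" for h
    using that dvd_imp_degree_le[of p h] by (auto simp: e_def)
  have H_nz: "h \<noteq> 0" if "h \<in> H" for h using that by (auto simp: H_def)
  have r_nz: "(X * h) mod p \<noteq> 0" if "h \<in> H" for h
  proof
    assume "(X * h) mod p = 0"
    hence "p dvd X * h" by (simp add: mod_eq_0_iff_dvd)
    hence "p dvd h" using pX prime_elem_dvd_mult_iff[OF p_elem] by blast
    thus False using not_dvd_small[of h] that H_nz by (auto simp: H_def)
  qed
  hence s_nz: "s h \<noteq> 0" if "h \<in> H" for h using that by (simp add: s_def)
  have r_deg: "degree (f mod p) < e" for f
    using degree_mod_less'[of p f] pm by (cases "f mod p = 0") (auto simp: e_def)
  have T_cong: "[X * h = [:s h:] * T h] (mod p)" if "h \<in> H" for h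
    using s_nz[OF that] by (simp add: T_def cong_def)
  \<comment> \<open>\<open>T\<close> is multiplication by \<open>X - c\<close> followed by making the remainder monic.\<close>
  have T_H: "T ` H \<subseteq> H"
  proof safe
    fix h assume "h \<in> H"
    thus "T h \<in> H"
      using s_nz[of h] r_deg[of "X * h"] by (simp add: H_def T_def s_def)
  qed
  have "inj_on T H"
  proof (rule inj_onI)
    fix h h' assume hh: "h \<in> H" "h' \<in> H" and eq: "T h = T h'"
    have sm: "T h = (X * smult (inverse (s h)) h) mod p" for h
      by (simp add: T_def mod_smult_left)
    have "[X * smult (inverse (s h)) h = X * smult (inverse (s h')) h'] (mod p)"
      using eq unfolding sm cong_def .
    hence "p dvd X * (smult (inverse (s h)) h - smult (inverse (s h')) h')"
      unfolding cong_iff_dvd_diff by (simp add: right_diff_distrib)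
    hence "p dvd smult (inverse (s h)) h - smult (inverse (s h')) h'"
      using pX prime_elem_dvd_mult_iff[OF p_elem] by blast
    moreover have "degree (smult (inverse (s h)) h - smult (inverse (s h')) h') < e"
      using hh by (intro degree_diff_less) (auto simp: H_def intro: le_less_trans[OF degree_smult_le])
    ultimately have "smult (inverse (s h)) h = smult (inverse (s h')) h'"
      using not_dvd_small right_minus_eq by metis
    moreover from this have "inverse (s h) = inverse (s h')"
      using hh by (metis (mono_tags, lifting) H_def lead_coeff_smult mem_Collect_eq mult_1_right)
    ultimately have "smult (s h') (smult (inverse (s h')) h) = smult (s h') (smult (inverse (s h')) h')"
      by simp
    thus "h = h'" using s_nz[OF hh(2)] by simp
  qed
  hence T_bij: "T ` H = H" "inj_on T H"
    using endo_inj_surj[OF finH T_H] by auto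
  have prodT: "(\<Prod>h\<in>H. T h) = \<Prod>H"
    using prod.reindex[OF T_bij(2), of "\<lambda>h. h"] T_bij(1) by simp
  have "[(\<Prod>h\<in>H. X * h) = (\<Prod>h\<in>H. [:s h:] * T h)] (mod p)"
    by (intro cong_prod T_cong)
  also have "(\<Prod>h\<in>H. X * h) = X ^ card H * \<Prod>H"
    by (simp add: prod.distrib)
  also have "(\<Prod>h\<in>H. [:s h:] * T h) = (\<Prod>h\<in>H. [:s h:]) * \<Prod>H"
    unfolding prod.distrib prodT ..
  also have "(\<Prod>h\<in>H. [:s h:]) = [:\<Prod>h\<in>H. s h:]"
    by (induction H rule: infinite_finite_induct) (auto simp: one_pCons)
  finally have "p dvd (X ^ card H - [:\<Prod>h\<in>H. s h:]) * \<Prod>H"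
    unfolding cong_iff_dvd_diff by (simp add: left_diff_distrib)
  moreover have "\<not> p dvd \<Prod>H"
    using not_dvd_small H_nz
    by (subst prime_dvd_prod_iff[OF finH p]) (auto simp: H_def)
  ultimately have "[X ^ card H = [:\<Prod>h\<in>H. s h:]] (mod p)"
    unfolding cong_iff_dvd_diff using prime_elem_dvd_mult_iff[OF p_elem] by blast
  moreover have "(\<Prod>h\<in>H. s h) = (- 1) ^ e * poly p c"
  proof -
    have deg_Xh: "degree (X * h) = Suc (degree h)"
      "lead_coeff (X * h) = lead_coeff h" if "h \<noteq> 0" for h
    proof -
      show "degree (X * h) = Suc (degree h)"
        using that by (simp add: X_def degree_mult_eq del: mult_pCons_left)
      show "lead_coeff (X * h) = lead_coeff h"
        unfolding lead_coeff_mult by (simp add: X_def)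
    qed
    have "(\<Prod>h\<in>H. s h) = (\<Prod>h\<in>monics e'. s h)"
    proof (rule prod.mono_neutral_right[OF finH])
      show "monics e' \<subseteq> H" by (auto simp: H_def monics_def e')
      show "\<forall>h\<in>H - monics e'. s h = 1"
      proof
        fix h assume h: "h \<in> H - monics e'"
        hence "degree h < e'" by (auto simp: H_def monics_def e' less_Suc_eq)
        hence "degree (X * h) < degree p"
          using h H_nz deg_Xh e' by (auto simp: e_def)
        thus "s h = 1"
          using h H_nz by (auto simp: s_def mod_poly_less deg_Xh(2)) (auto simp: H_def)
      qed
    qed
    also have "\<dots> = (\<Prod>f\<in>{f. degree f < Suc e' \<and> poly f c = - poly p c}. lead_coeff f)"
    proof (rule prod.reindex_bij_witness[where j = "\<lambda>h. X * h - p" and i = "\<lambda>f. (f + p) div X"])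
      fix h :: "'a mod_ring poly" assume h: "h \<in> monics e'"
      have X0: "X \<noteq> 0" by (simp add: X_def)
      show "(X * h - p + p) div X = h" using X0 by simp
      have hm: "degree (X * h) = degree p" "lead_coeff (X * h) = 1"
        using h deg_Xh[of h] monics_nonzero[OF h] e' by (auto simp: monics_def e_def)
      note m = mod_poly_eq_diff_monic[OF hm pm(1,2)]
      show "X * h - p \<in> {f. degree f < Suc e' \<and> poly f c = - poly p c}"
        using m(2) e' by (simp add: e_def) (simp add: X_def)
      show "lead_coeff (X * h - p) = s h"
        unfolding s_def m(1) ..
    next
      fix f :: "'a mod_ring poly"
      assume f: "f \<in> {f. degree f < Suc e' \<and> poly f c = - poly p c}"
      have "X dvd f + p" using f by (simp add: X_def poly_eq_0_iff_dvd[symmetric])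
      hence Xd: "X * ((f + p) div X) = f + p" by (rule dvd_mult_div_cancel)
      thus "X * ((f + p) div X) - p = f" by simp
      have less: "degree f < degree p" using f e' by (simp add: e_def)
      have d: "degree (f + p) = Suc e'"
        using degree_add_eq_right[OF less] e' by (simp add: e_def)
      have l: "lead_coeff (f + p) = 1"
        using less pm(1) degree_add_eq_right[OF less] by (simp add: coeff_eq_0)
      have nz: "(f + p) div X \<noteq> 0" using Xd d by auto
      show "(f + p) div X \<in> monics e'"
        using deg_Xh[OF nz] unfolding Xd using d l by (simp add: monics_def)
    qed
    also have "\<dots> = (- 1) ^ e' * (- poly p c)"
      by (rule prod_lead_coeffs_fixed_value) (use False in simp)
    finally show ?thesis by (simp add: e')
  qed
  ultimately show ?thesis by (simp add: cardH X_def)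
qed

lemma geometric_sum_nat: "(q - 1) * (\<Sum>i<n. q ^ i) = q ^ n - (1::nat)"
proof (cases "q = 0")
  case True
  thus ?thesis by (cases n) auto
next
  case False
  have "(q - 1) * (\<Sum>i<n. q ^ i) + 1 = q ^ n"
  proof (induction n)
    case (Suc n)
    have "(q - 1) * (\<Sum>i<Suc n. q ^ i) + 1 = (q - 1) * (\<Sum>i<n. q ^ i) + 1 + (q - 1) * q ^ n"
      by (simp add: algebra_simps)
    also have "\<dots> = q ^ n + (q - 1) * q ^ n" by (simp only: Suc.IH)
    also have "\<dots> = q ^ Suc n" using False by (cases q) auto
    finally show ?case .
  qed simp
  thus ?thesis by simp
qed

text \<open>
  Fermat's little theorem modulo \<open>p\<close> follows from the norm congruence at \<open>c = 0\<close>: the power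
  \<open>(q\<^sup>e - 1) / (q - 1)\<close> of \<open>X\<close> is a nonzero constant, whose power \<open>q - 1\<close> is \<open>1\<close>.
\<close>

lemma monom_frobenius_cong:
  fixes p :: "'a::odd_prime_card mod_ring poly"
  assumes p: "prime p" and "degree p * k = n"
  shows "[Polynomial.monom 1 (CARD('a) ^ n) = Polynomial.monom 1 1] (mod p)"
proof -
  let ?q = "CARD('a)" and ?e = "degree p"
  define X :: "'a mod_ring poly" where "X = Polynomial.monom 1 1"
  have X_eq: "X = [:- 0, 1:]" by (simp add: X_def monom_altdef)
  have base: "[X ^ (?q ^ ?e) = X] (mod p)"
  proof (cases "poly p 0 = 0")
    case True
    hence "p dvd X" using prime_poly_dvd_linear_iff[OF p, of 0] X_eq by simp
    moreover have "?q ^ ?e > 0" by simp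
    ultimately have "p dvd X ^ (?q ^ ?e)" by (meson dvd_trans dvd_power)
    with \<open>p dvd X\<close> show ?thesis by (simp add: cong_iff_dvd_diff)
  next
    case False
    define u where "u = (- 1) ^ ?e * poly p 0"
    have u0: "u \<noteq> 0" using False by (simp add: u_def)
    have "[X ^ (\<Sum>i<?e. ?q ^ i) = [:u:]] (mod p)"
      using linear_power_cong_norm[OF p, of 0] unfolding X_eq u_def .
    hence "[(X ^ (\<Sum>i<?e. ?q ^ i)) ^ (?q - 1) = [:u:] ^ (?q - 1)] (mod p)"
      by (rule cong_pow)
    also have "(X ^ (\<Sum>i<?e. ?q ^ i)) ^ (?q - 1) = X ^ (?q ^ ?e - 1)"
      by (metis power_mult mult.commute geometric_sum_nat)
    also have "[:u:] ^ (?q - 1) = 1"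
      using power_card_minus_1[OF u0] by (simp add: poly_const_pow one_pCons)
    finally have "[X * X ^ (?q ^ ?e - 1) = X * 1] (mod p)"
      by (rule cong_scalar_left)
    moreover have "X * X ^ (?q ^ ?e - 1) = X ^ (?q ^ ?e)"
      by (metis power_Suc Suc_diff_1 zero_less_power zero_less_card_finite)
    ultimately show ?thesis by simp
  qed
  have "[X ^ (?q ^ (?e * k)) = X] (mod p)" for k
  proof (induction k)
    case (Suc k)
    have "X ^ (?q ^ (?e * Suc k)) = (X ^ (?q ^ (?e * k))) ^ (?q ^ ?e)"
      by (simp add: power_add power_mult[symmetric] mult.commute)
    moreover have "[(X ^ (?q ^ (?e * k))) ^ (?q ^ ?e) = X ^ (?q ^ ?e)] (mod p)"
      by (rule cong_pow[OF Suc.IH])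
    ultimately show ?case using base cong_trans by metis
  qed simp
  from this[of k] show ?thesis
    by (simp add: X_def monom_power assms(2))
qed

text \<open>
  All \<open>k\<close> exponents in the sum are odd.
\<close>

lemma sign_power_odd_sum:
  fixes x :: int
  assumes "x \<in> {0, 1, -1}" "k > 0" "odd q"
  shows "x ^ (\<Sum>i<k. q ^ (e * i)) = x ^ k"
proof -
  have "x ^ (\<Sum>i<k. q ^ (e * i)) = (\<Prod>i<k. x ^ (q ^ (e * i)))"
    by (simp add: power_sum)
  also have "\<dots> = (\<Prod>i<k. x)"
    using assms(1,3) by (intro prod.cong refl) (auto simp: power_0_left elim: oddE)
  finally show ?thesis by simp
qed

text \<open>
  Euler's criterion together with reciprocity. The exponent factors as
  \<open>(q\<^sup>e - 1) / (q - 1)\<close> times \<open>(q - 1) / 2\<close> times a sum of \<open>k\<close> odd numbers: the three factors take the norm,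
  apply \<open>\<chi>\<close>, and raise to the power \<open>k\<close>. The sign \<open>(-1)\<^sup>e\<close> in the norm disappears because
  \<open>e k\<close> is even.
\<close>

theorem linear_euler_cong:
  fixes p :: "'a::odd_prime_card mod_ring poly"
  assumes p: "prime p" and n: "degree p * k = n" "n > 0" "even n"
  shows "[[:- c, 1:] ^ ((CARD('a) ^ n - 1) div 2) = [:of_int (quad_char (poly p c) ^ k):]] (mod p)"
proof -
  let ?q = "CARD('a)" and ?e = "degree p"
  define u where "u = (- 1) ^ ?e * poly p c"
  define M where "M = (\<Sum>i<?e. ?q ^ i)"
  define K where "K = (\<Sum>i<k. ?q ^ (?e * i))"
  have k: "k > 0" using n by (cases k) auto
  have "(?q - 1) * M * K = (?q ^ ?e - 1) * K"
    unfolding M_def geometric_sum_nat ..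
  also have "\<dots> = ?q ^ n - 1"
    unfolding K_def power_mult geometric_sum_nat n(1)[symmetric] ..
  finally have "?q ^ n - 1 = 2 * ((?q - 1) div 2 * M * K)"
    using half_card[where 'a='a] by (simp add: mult.assoc[symmetric])
  hence expo: "(?q ^ n - 1) div 2 = M * ((?q - 1) div 2) * K" by simp
  have "[[:- c, 1:] ^ M = [:u:]] (mod p)"
    unfolding M_def u_def by (rule linear_power_cong_norm[OF p])
  hence "[(([:- c, 1:] ^ M) ^ ((?q - 1) div 2)) ^ K = ([:u:] ^ ((?q - 1) div 2)) ^ K] (mod p)"
    by (intro cong_pow)
  also have "(([:- c, 1:] ^ M) ^ ((?q - 1) div 2)) ^ K = [:- c, 1:] ^ ((?q ^ n - 1) div 2)"
    unfolding expo power_mult ..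
  also have "([:u:] ^ ((?q - 1) div 2)) ^ K = [:of_int (quad_char u ^ K):]"
    by (simp add: poly_const_pow quad_char_euler)
  also have "quad_char u ^ K = quad_char u ^ k"
    unfolding K_def by (rule sign_power_odd_sum[OF quad_char_cases k odd_card])
  also have "quad_char u ^ k = quad_char (poly p c) ^ k"
  proof -
    have "quad_char u ^ k = (quad_char (- 1 :: 'a mod_ring)) ^ n * quad_char (poly p c) ^ k"
      unfolding u_def quad_char_mult quad_char_power n(1)[symmetric]
      by (simp add: power_mult_distrib power_mult)
    thus ?thesis using n(3) by (simp add: quad_char_even_power)
  qed
  finally show ?thesis .
qed

section \<open>The logarithmic derivative of an L-series over a polynomial ring\<close>

text \<open>
  The coefficient of \<open>t\<^sup>n\<close> in the L-series of \<open>\<psi>\<close>.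
\<close>

definition char_sum :: "('a::comm_semiring_1 poly \<Rightarrow> int) \<Rightarrow> nat \<Rightarrow> int" where
  "char_sum \<psi> n = (\<Sum>f\<in>monics n. \<psi> f)"

definition prime_powers_of_degree :: "nat \<Rightarrow> ('a::field_gcd poly \<times> nat) set" where
  "prime_powers_of_degree s = {(p, k). prime p \<and> degree p * k = s}"

text \<open>
  The coefficient of \<open>t\<^sup>s\<close> in \<open>t L' / L\<close>, where \<open>L\<close> is the L-series of \<open>\<psi>\<close>; the weight
  \<open>degree p\<close> plays the part of the von Mangoldt function.
\<close>

definition mangoldt_sum :: "('a::field_gcd poly \<Rightarrow> int) \<Rightarrow> nat \<Rightarrow> int" where
  "mangoldt_sum \<psi> s = (\<Sum>(p, k)\<in>prime_powers_of_degree s. int (degree p) * \<psi> p ^ k)"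

lemma finite_prime_powers_of_degree:
  assumes "s > 0"
  shows "finite (prime_powers_of_degree s :: ('a::{field_gcd,finite} poly \<times> nat) set)"
proof (rule finite_subset)
  show "prime_powers_of_degree s \<subseteq> {p :: 'a poly. degree p < Suc s} \<times> {..s}"
    using assms prime_poly_monic(2) by (fastforce simp: prime_powers_of_degree_def less_Suc_eq_le)
  show "finite ({p :: 'a poly. degree p < Suc s} \<times> {..s})"
    by (intro finite_cartesian_product finite_degree_less) auto
qed

text \<open>
  The polynomial analogue of the fact that the von Mangoldt function sums to \<open>log n\<close> over the divisors of
  \<open>n\<close>: the prime \<open>p\<close> contributes its degree once for every \<open>k\<close> up to its multiplicity.
\<close>

lemma degree_eq_sum_prime_powers:
  fixes f :: "'a::{field_gcd,finite} poly"
  assumes "f \<noteq> 0"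
  shows "degree f = (\<Sum>s\<in>{1..degree f}.
           \<Sum>(p, k)\<in>prime_powers_of_degree s. if p ^ k dvd f then degree p else 0)"
proof -
  let ?r = "degree f"
  let ?PP = "SIGMA p:prime_factors f. {1..multiplicity p f}"
  have "?r = degree (normalize f)"
    by (simp add: normalize_poly_eq_map_poly degree_map_poly)
  also have "\<dots> = degree (\<Prod>p\<in>prime_factors f. p ^ multiplicity p f)"
    by (simp add: prod_prime_factors assms)
  also have "\<dots> = (\<Sum>p\<in>prime_factors f. degree (p ^ multiplicity p f))"
    by (rule degree_prod_eq_sum_degree) (auto dest: in_prime_factors_imp_prime)
  also have "\<dots> = (\<Sum>p\<in>prime_factors f. multiplicity p f * degree p)"
  proof (rule sum.cong[OF refl])
    fix p assume "p \<in> prime_factors f"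
    hence "p \<noteq> 0" by (auto dest: in_prime_factors_imp_prime)
    thus "degree (p ^ multiplicity p f) = multiplicity p f * degree p"
      by (simp add: degree_power_eq mult.commute)
  qed
  also have "\<dots> = (\<Sum>p\<in>prime_factors f. \<Sum>k\<in>{1..multiplicity p f}. degree p)"
    by simp
  also have "\<dots> = (\<Sum>(p, k)\<in>?PP. degree p)"
    by (rule sum.Sigma) auto
  also have "?PP = (\<Union>s\<in>{1..?r}. {(p, k)\<in>prime_powers_of_degree s. p ^ k dvd f})"
  proof (intro equalityI subsetI)
    fix x assume "x \<in> ?PP"
    then obtain p k where x: "x = (p, k)" "p \<in> prime_factors f" "k \<ge> 1" "k \<le> multiplicity p f"
      by auto
    have p: "prime p" using x by auto
    have dvd: "p ^ k dvd f" using x(4) by (rule multiplicity_dvd')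
    have "degree p * k \<le> ?r"
      using dvd_imp_degree_le[OF dvd assms] p by (simp add: degree_power_eq mult.commute)
    moreover have "degree p * k \<ge> 1"
      using prime_poly_monic(2)[OF p] x(3) by simp
    ultimately show "x \<in> (\<Union>s\<in>{1..?r}. {(p, k)\<in>prime_powers_of_degree s. p ^ k dvd f})"
      using x(1) p dvd by (auto simp: prime_powers_of_degree_def)
  next
    fix x assume "x \<in> (\<Union>s\<in>{1..?r}. {(p, k)\<in>prime_powers_of_degree s. p ^ k dvd f})"
    then obtain p k where x: "x = (p, k)" "prime p" "p ^ k dvd f" "degree p * k \<ge> 1"
      by (auto simp: prime_powers_of_degree_def)
    have k: "k \<ge> 1" using x(4) by (cases k) auto
    have "k \<le> multiplicity p f"
      using x(2,3) assms prime_poly_monic(2)[OF x(2)] by (intro multiplicity_geI) auto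
    moreover have "p dvd f" using x(3) k by (meson dvd_power dvd_trans less_le_trans zero_less_one)
    ultimately show "x \<in> ?PP"
      using x k assms by (auto simp: in_prime_factors_iff)
  qed
  also have "(\<Sum>(p, k)\<in>(\<Union>s\<in>{1..?r}. {(p, k)\<in>prime_powers_of_degree s. p ^ k dvd f}). degree p)
      = (\<Sum>s\<in>{1..?r}. \<Sum>(p, k)\<in>{(p, k)\<in>prime_powers_of_degree s. p ^ k dvd f}. degree p)"
  proof (rule sum.UNION_disjoint)
    show "\<forall>s\<in>{1..?r}. finite {(p, k)\<in>prime_powers_of_degree s. p ^ k dvd f}"
      by (auto intro!: finite_subset[OF _ finite_prime_powers_of_degree])
  qed (auto simp: prime_powers_of_degree_def)
  also have "\<dots> = (\<Sum>s\<in>{1..?r}.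
           \<Sum>(p, k)\<in>prime_powers_of_degree s. if p ^ k dvd f then degree p else 0)"
  proof (rule sum.cong[OF refl])
    fix s assume "s \<in> {1..?r}"
    hence "finite (prime_powers_of_degree s :: ('a poly \<times> nat) set)"
      by (intro finite_prime_powers_of_degree) auto
    thus "(\<Sum>(p, k)\<in>{(p, k)\<in>prime_powers_of_degree s. p ^ k dvd f}. degree p)
      = (\<Sum>(p, k)\<in>prime_powers_of_degree s. if p ^ k dvd f then degree p else 0)"
      by (intro sum.mono_neutral_cong_left) (auto split: if_splits)
  qed
  finally show ?thesis .
qed

text \<open>
  This is \<open>t L' = (t L' / L) L\<close>, compared coefficientwise. The degree of each \<open>f\<close> is split over the prime powers
  \<open>p\<^sup>k\<close> that divide \<open>f\<close>, and \<open>f = p\<^sup>k h\<close> with \<open>h\<close> monic.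
\<close>

theorem log_derivative_identity:
  fixes \<psi> :: "'a::{field_gcd,finite} poly \<Rightarrow> int"
  assumes one: "\<psi> 1 = 1" and mult: "\<And>f g. \<psi> (f * g) = \<psi> f * \<psi> g"
  shows "int r * char_sum \<psi> r = (\<Sum>s\<in>{1..r}. mangoldt_sum \<psi> s * char_sum \<psi> (r - s))"
proof -
  have pow: "\<psi> (f ^ k) = \<psi> f ^ k" for f k
    by (induction k) (simp_all add: one mult)
  have inner: "(\<Sum>f\<in>monics r. if p ^ k dvd f then \<psi> f else 0) = \<psi> p ^ k * char_sum \<psi> (r - s)"
    if pk: "(p, k) \<in> prime_powers_of_degree s" and s: "s \<le> r" for p k s
  proof -
    have p: "prime p" "degree p * k = s"
      using pk by (auto simp: prime_powers_of_degree_def)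
    note pm = prime_poly_monic[OF p(1)]
    have pk0: "p ^ k \<noteq> 0" using pm by simp
    have deg_pk: "degree (p ^ k) = s"
      using p pm by (simp add: degree_power_eq mult.commute)
    have lc_pk: "lead_coeff (p ^ k) = 1"
      using pm by (simp add: lead_coeff_power)
    have "(\<Sum>f\<in>monics r. if p ^ k dvd f then \<psi> f else 0) = (\<Sum>f\<in>{f\<in>monics r. p ^ k dvd f}. \<psi> f)"
      by (rule sum.mono_neutral_cong_right) (auto simp: finite_monics)
    also have "\<dots> = (\<Sum>h\<in>monics (r - s). \<psi> (p ^ k * h))"
    proof (rule sum.reindex_bij_witness[where i = "\<lambda>h. p ^ k * h" and j = "\<lambda>f. f div p ^ k"])
      fix f assume f: "f \<in> {f\<in>monics r. p ^ k dvd f}"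
      hence "p ^ k dvd f" by simp
      then obtain h where h: "f = p ^ k * h" by (rule dvdE)
      have "f \<noteq> 0" using f monics_nonzero by blast
      hence h0: "h \<noteq> 0" using h by auto
      have d: "f div p ^ k = h" unfolding h by (rule nonzero_mult_div_cancel_left[OF pk0])
      have "degree f = s + degree h"
        unfolding h using pk0 h0 deg_pk by (simp add: degree_mult_eq)
      moreover have "lead_coeff f = lead_coeff h"
        unfolding h lead_coeff_mult lc_pk by simp
      ultimately show "f div p ^ k \<in> monics (r - s)"
        unfolding d using f by (auto simp: monics_def)
      show "p ^ k * (f div p ^ k) = f" using d h by simp
      show "\<psi> (p ^ k * (f div p ^ k)) = \<psi> f" using d h by simp
    next
      fix h :: "'a poly" assume h: "h \<in> monics (r - s)"
      show "p ^ k * h div p ^ k = h" by (rule nonzero_mult_div_cancel_left[OF pk0])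
      have "degree (p ^ k * h) = s + degree h"
        using pk0 monics_nonzero[OF h] deg_pk by (simp add: degree_mult_eq)
      moreover have "lead_coeff (p ^ k * h) = lead_coeff h"
        unfolding lead_coeff_mult lc_pk by simp
      ultimately show "p ^ k * h \<in> {f\<in>monics r. p ^ k dvd f}"
        using h s by (auto simp: monics_def)
    qed
    also have "\<dots> = \<psi> p ^ k * char_sum \<psi> (r - s)"
      by (simp add: mult pow char_sum_def sum_distrib_left)
    finally show ?thesis .
  qed
  have "int r * char_sum \<psi> r = (\<Sum>f\<in>monics r. int (degree f) * \<psi> f)"
    unfolding char_sum_def sum_distrib_left by (rule sum.cong) (auto simp: monics_def)
  also have "\<dots> = (\<Sum>f\<in>monics r. \<Sum>s\<in>{1..r}. \<Sum>(p, k)\<in>prime_powers_of_degree s.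
      int (degree p) * (if p ^ k dvd f then \<psi> f else 0))"
  proof (rule sum.cong[OF refl])
    fix f :: "'a poly" assume f: "f \<in> monics r"
    hence "degree f = r" by (simp add: monics_def)
    hence "int (degree f) = (\<Sum>s\<in>{1..r}.
           \<Sum>(p, k)\<in>prime_powers_of_degree s. int (if p ^ k dvd f then degree p else 0))"
      by (subst degree_eq_sum_prime_powers[OF monics_nonzero[OF f]]) (simp add: case_prod_unfold)
    thus "int (degree f) * \<psi> f = (\<Sum>s\<in>{1..r}. \<Sum>(p, k)\<in>prime_powers_of_degree s.
      int (degree p) * (if p ^ k dvd f then \<psi> f else 0))"
      by (simp only: sum_distrib_right case_prod_unfold) (intro sum.cong refl, auto)
  qed
  also have "\<dots> = (\<Sum>s\<in>{1..r}. \<Sum>f\<in>monics r. \<Sum>(p, k)\<in>prime_powers_of_degree s.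
      int (degree p) * (if p ^ k dvd f then \<psi> f else 0))"
    by (rule sum.swap)
  also have "\<dots> = (\<Sum>s\<in>{1..r}. \<Sum>(p, k)\<in>prime_powers_of_degree s. \<Sum>f\<in>monics r.
      int (degree p) * (if p ^ k dvd f then \<psi> f else 0))"
    unfolding case_prod_unfold by (intro sum.cong refl sum.swap)
  also have "\<dots> = (\<Sum>s\<in>{1..r}. mangoldt_sum \<psi> s * char_sum \<psi> (r - s))"
    unfolding mangoldt_sum_def sum_distrib_right
    by (intro sum.cong refl) (auto simp: sum_distrib_left[symmetric] inner mult.assoc)
  finally show ?thesis .
qed

text \<open>
  For the trivial character the L-series is \<open>1 / (1 - q t)\<close>. The result is the prime polynomial theorem in its exact
  form: the degrees of the primes whose degree divides \<open>s\<close> add up to \<open>q\<^sup>s\<close>.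
\<close>

lemma mangoldt_sum_trivial:
  assumes "s > 0"
  shows "mangoldt_sum (\<lambda>_ :: 'a::{field_gcd,finite} poly. 1) s = int (CARD('a) ^ s)"
  using assms
proof (induction s rule: less_induct)
  case (less s)
  let ?q = "int CARD('a)"
  let ?one = "\<lambda>_ :: 'a poly. 1 :: int"
  have c: "char_sum ?one n = ?q ^ n" for n
    by (simp add: char_sum_def card_monics)
  have "int s * ?q ^ s = (\<Sum>i\<in>{1..s}. mangoldt_sum ?one i * ?q ^ (s - i))"
    using log_derivative_identity[of ?one s] by (simp add: c)
  also have "{1..s} = insert s {1..<s}" using less.prems by auto
  also have "(\<Sum>i\<in>insert s {1..<s}. mangoldt_sum ?one i * ?q ^ (s - i))
      = mangoldt_sum ?one s + (\<Sum>i\<in>{1..<s}. mangoldt_sum ?one i * ?q ^ (s - i))"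
    by simp
  also have "(\<Sum>i\<in>{1..<s}. mangoldt_sum ?one i * ?q ^ (s - i)) = (\<Sum>i\<in>{1..<s}. ?q ^ s)"
    by (intro sum.cong refl) (auto simp: less.IH simp flip: power_add)
  also have "\<dots> = int s * ?q ^ s - ?q ^ s"
    using less.prems by (simp add: of_nat_diff algebra_simps)
  finally show ?case by simp
qed

section \<open>Power sums and inverse roots\<close>

lemma unit_circle_geometric_sum_bounded:
  fixes u :: complex
  assumes "norm u \<le> 1" "u \<noteq> 1"
  shows "norm (\<Sum>r<n. u ^ r) \<le> 2 / norm (1 - u)"
proof -
  have "(1 - u) * (\<Sum>r<n. u ^ r) = 1 - u ^ n"
    by (rule one_diff_power_eq[symmetric])
  hence "norm (1 - u) * norm (\<Sum>r<n. u ^ r) = norm (1 - u ^ n)"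
    by (metis norm_mult)
  also have "\<dots> \<le> norm (1::complex) + norm (u ^ n)" by (rule norm_triangle_ineq4)
  also have "\<dots> \<le> 2" using assms(1) by (simp add: norm_power power_le_one)
  finally show ?thesis
    using assms(2) by (simp add: pos_le_divide_eq mult.commute)
qed

text \<open>
  Suppose that the largest modulus \<open>\<rho>\<close>, attained at \<open>z m\<close>, exceeds \<open>B\<close>. Divide the \<open>r\<close>-th power sum by
  \<open>(z m)\<^sup>r\<close> and add up over \<open>n\<close> consecutive \<open>r\<close>. The assumption bounds the result by a convergent geometric
  series. On the other hand every index with \<open>z j = z m\<close> contributes \<open>n\<close>, and all others contribute bounded
  geometric sums, so the result grows linearly in \<open>n\<close>.
\<close>

theorem norm_le_of_power_sums_bounded:
  fixes z :: "'i \<Rightarrow> complex"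
  assumes fin: "finite I" and B: "B > 0"
    and bound: "\<And>r. r \<ge> N \<Longrightarrow> norm (\<Sum>i\<in>I. z i ^ r) \<le> K * B ^ r"
    and i: "i \<in> I"
  shows "norm (z i) \<le> B"
proof (rule ccontr)
  assume "\<not> norm (z i) \<le> B"
  define \<rho> where "\<rho> = Max ((\<lambda>j. norm (z j)) ` I)"
  have "\<rho> \<in> (\<lambda>j. norm (z j)) ` I"
    unfolding \<rho>_def by (rule Max_in) (use fin i in auto)
  then obtain m where m: "m \<in> I" "norm (z m) = \<rho>" by auto
  have le_\<rho>: "norm (z j) \<le> \<rho>" if "j \<in> I" for j
    unfolding \<rho>_def by (rule Max_ge) (use fin that in auto)
  have \<rho>: "\<rho> > B" using le_\<rho>[OF i] \<open>\<not> norm (z i) \<le> B\<close> by linarith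
  hence zm: "z m \<noteq> 0" using m(2) B by auto
  define u where "u = (\<lambda>j. z j / z m)"
  have u_le: "norm (u j) \<le> 1" if "j \<in> I" for j
    using le_\<rho>[OF that] m(2) \<rho> B by (simp add: u_def norm_divide)
  define c where "c = (\<lambda>j. if u j = 1 then 0 else 2 / norm (1 - u j))"
  define M where "M = card {j\<in>I. u j = 1}"
  have M: "M \<ge> 1"
    unfolding M_def using fin m(1) zm by (auto simp: card_gt_0_iff Suc_le_eq u_def)
  define t where "t = B / \<rho>"
  have t: "0 \<le> t" "t < 1" using \<rho> B by (auto simp: t_def)
  have K0: "K \<ge> 0"
    using order_trans[OF norm_ge_zero bound[of N]] B by (simp add: zero_le_mult_iff) (meson not_le zero_less_power)
  have main: "real n \<le> K / (1 - t) + (\<Sum>j\<in>I. c j)" for n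
  proof -
    define T where "T = (\<Sum>r<n. \<Sum>j\<in>I. u j ^ (N + r))"
    have "norm T \<le> (\<Sum>r<n. K * t ^ r)"
      unfolding T_def
    proof (rule sum_norm_le)
      fix r
      have "(\<Sum>j\<in>I. u j ^ (N + r)) = (\<Sum>j\<in>I. z j ^ (N + r)) / z m ^ (N + r)"
        by (simp add: u_def power_divide sum_divide_distrib)
      hence "norm (\<Sum>j\<in>I. u j ^ (N + r)) = norm (\<Sum>j\<in>I. z j ^ (N + r)) / \<rho> ^ (N + r)"
        by (simp add: norm_divide norm_power m(2))
      also have "\<dots> \<le> K * B ^ (N + r) / \<rho> ^ (N + r)"
        using \<rho> B by (intro divide_right_mono bound) auto
      also have "\<dots> = K * (t ^ N * t ^ r)"
        by (simp add: t_def power_divide power_add)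
      also have "\<dots> \<le> K * (1 * t ^ r)"
        using t K0 by (intro mult_left_mono mult_right_mono power_le_one) auto
      finally show "norm (\<Sum>j\<in>I. u j ^ (N + r)) \<le> K * t ^ r" by simp
    qed
    also have "\<dots> = K * ((1 - t ^ n) / (1 - t))"
      using t by (simp add: sum_distrib_left[symmetric] sum_gp_strict)
    also have "\<dots> \<le> K * (1 / (1 - t))"
      using t K0 by (intro mult_left_mono divide_right_mono) auto
    finally have T_le: "norm T \<le> K / (1 - t)" by simp
    have T_eq: "T = (\<Sum>j\<in>I. u j ^ N * (\<Sum>r<n. u j ^ r))"
      unfolding T_def by (subst sum.swap) (simp add: power_add sum_distrib_left)
    have "(\<Sum>j\<in>I. if u j = 1 then of_nat n else 0) = (of_nat (M * n) :: complex)"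
      using fin by (simp add: M_def sum.If_cases Int_def)
    hence "norm (T - of_nat (M * n)) = norm (\<Sum>j\<in>I. u j ^ N * (\<Sum>r<n. u j ^ r) - (if u j = 1 then of_nat n else 0))"
      unfolding T_eq by (simp only: sum_subtractf)
    also have "\<dots> \<le> (\<Sum>j\<in>I. c j)"
    proof (rule sum_norm_le)
      fix j assume j: "j \<in> I"
      show "norm (u j ^ N * (\<Sum>r<n. u j ^ r) - (if u j = 1 then of_nat n else 0)) \<le> c j"
      proof (cases "u j = 1")
        case False
        have "norm (u j ^ N) * norm (\<Sum>r<n. u j ^ r) \<le> 1 * (2 / norm (1 - u j))"
          using u_le[OF j] False
          by (intro mult_mono unit_circle_geometric_sum_bounded) (auto simp: norm_power power_le_one)
        thus ?thesis using False by (simp add: c_def norm_mult)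
      qed (simp add: c_def)
    qed
    finally have "norm (of_nat (M * n) :: complex) \<le> norm T + (\<Sum>j\<in>I. c j)"
      using norm_triangle_ineq2[of "of_nat (M * n)" T] by (simp add: norm_minus_commute)
    hence "real (M * n) \<le> K / (1 - t) + (\<Sum>j\<in>I. c j)"
      using T_le unfolding norm_of_nat by linarith
    moreover have "real n \<le> real (M * n)" using M by (intro of_nat_mono) simp
    ultimately show ?thesis by linarith
  qed
  obtain n :: nat where "real n > K / (1 - t) + (\<Sum>j\<in>I. c j)"
    using reals_Archimedean2 by blast
  with main[of n] show False by simp
qed

lemma fps_log_deriv_linear_factors:
  fixes w :: "'i \<Rightarrow> complex"
  assumes "finite I"
  shows "fps_X * fps_deriv (\<Prod>i\<in>I. 1 - fps_const (w i) * fps_X) =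
    - Abs_fps (\<lambda>n. if n = 0 then 0 else \<Sum>i\<in>I. w i ^ n) * (\<Prod>i\<in>I. 1 - fps_const (w i) * fps_X)"
  using assms
proof (induction I rule: finite_induct)
  case empty
  have "Abs_fps (\<lambda>n. if n = 0 then 0 else \<Sum>i\<in>({} :: 'i set). w i ^ n) = 0"
    by (simp add: fps_eq_iff)
  thus ?case by simp
next
  case (insert j I)
  let ?L = "\<Prod>i\<in>I. 1 - fps_const (w i) * fps_X"
  let ?l = "1 - fps_const (w j) * fps_X"
  let ?S = "\<lambda>I. Abs_fps (\<lambda>n. if n = 0 then 0 else \<Sum>i\<in>I. w i ^ n)"
  have S: "?S (insert j I) = ?S {j} + ?S I"
    using insert.hyps by (simp add: fps_eq_iff)
  have "?S {j} * ?l = ?S {j} - fps_const (w j) * (fps_X * ?S {j})"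
    by (simp add: algebra_simps)
  also have "\<dots> = fps_const (w j) * fps_X"
  proof (rule fps_ext)
    fix n
    show "fps_nth (?S {j} - fps_const (w j) * (fps_X * ?S {j})) n = fps_nth (fps_const (w j) * fps_X) n"
      by (cases n; cases "n - 1") auto
  qed
  finally have one: "fps_X * fps_deriv ?l = - ?S {j} * ?l" by simp
  have "fps_X * fps_deriv (f * g) = (fps_X * fps_deriv f) * g + f * (fps_X * fps_deriv g)"
    for f g :: "complex fps"
    by (simp add: algebra_simps)
  hence "fps_X * fps_deriv (?l * ?L) = (fps_X * fps_deriv ?l) * ?L + ?l * (fps_X * fps_deriv ?L)" .
  also have "\<dots> = - ?S (insert j I) * (?l * ?L)"
    unfolding one insert.IH S by (simp add: algebra_simps)
  finally show ?case using insert.hyps by simp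
qed

text \<open>
  The recursion says \<open>t A' = S A\<close> for the generating series. \<open>A\<close> is the reversal of a monic polynomial of
  degree \<open>D\<close>, hence a product of \<open>D\<close> factors \<open>1 - w\<^sub>i t\<close> (some \<open>w\<^sub>i\<close> may be zero), whose logarithmic
  derivative is explicit.
\<close>

theorem newton_inverse_roots:
  fixes A S :: "nat \<Rightarrow> complex"
  assumes A0: "A 0 = 1" and A_vanish: "\<And>n. n > D \<Longrightarrow> A n = 0"
    and rec: "\<And>r. of_nat r * A r = (\<Sum>s\<in>{1..r}. S s * A (r - s))"
  obtains w where "A 1 = - (\<Sum>i<D. w i)" "\<And>r. r > 0 \<Longrightarrow> S r = - (\<Sum>i<D. w i ^ r)"
proof -
  define P where "P = (\<Sum>i\<le>D. Polynomial.monom (A (D - i)) i)"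
  have coeff_P: "Polynomial.coeff P n = (if n \<le> D then A (D - n) else 0)" for n
    unfolding P_def by (simp add: Polynomial.coeff_sum)
  have deg_P: "degree P = D"
  proof (rule antisym)
    show "degree P \<le> D" by (rule degree_le) (simp add: coeff_P)
    show "D \<le> degree P" by (rule le_degree) (simp add: coeff_P A0)
  qed
  obtain w where w: "smult (lead_coeff P) (\<Prod>i<degree P. [:- w i, 1:]) = P"
    by (rule complex_poly_decompose')
  have P_eq: "P = (\<Prod>i<D. [:- w i, 1:])"
    using w by (simp add: deg_P coeff_P A0)
  have refl_lin: "reflect_poly [:- w i, 1:] = [:1, - w i:]" for i
    by (rule poly_eqI) (auto simp: coeff_reflect_poly coeff_pCons split: nat.splits)
  define L where "L = (\<Prod>i<D. 1 - fps_const (w i) * fps_X)"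
  have "fps_of_poly (reflect_poly P) = L"
    unfolding P_eq reflect_poly_prod refl_lin fps_of_poly_prod L_def
    by (intro prod.cong refl) (simp add: fps_of_poly_linear' fps_const_neg[symmetric] del: fps_const_neg)
  moreover have "fps_of_poly (reflect_poly P) = Abs_fps A"
    by (rule fps_ext) (auto simp: coeff_reflect_poly deg_P coeff_P A_vanish)
  ultimately have AL: "Abs_fps A = L" by simp
  define F where "F = Abs_fps (\<lambda>n. if n = 0 then 0 else S n)"
  define W where "W = Abs_fps (\<lambda>n. if n = 0 then 0 else \<Sum>i<D. w i ^ n)"
  have "fps_X * fps_deriv (Abs_fps A) = F * Abs_fps A"
  proof (rule fps_ext)
    fix r
    have "fps_nth (F * Abs_fps A) r = (\<Sum>s=0..r. fps_nth F s * A (r - s))"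
      by (simp add: fps_mult_nth)
    also have "\<dots> = (\<Sum>s\<in>{1..r}. S s * A (r - s))"
      by (rule sum.mono_neutral_cong_right) (auto simp: F_def)
    also have "\<dots> = of_nat r * A r" by (rule rec[symmetric])
    also have "\<dots> = fps_nth (fps_X * fps_deriv (Abs_fps A)) r" by (cases r) auto
    finally show "fps_nth (fps_X * fps_deriv (Abs_fps A)) r = fps_nth (F * Abs_fps A) r" by simp
  qed
  moreover have "fps_X * fps_deriv L = - W * L"
    unfolding L_def W_def by (rule fps_log_deriv_linear_factors) simp
  ultimately have "F * L = - W * L" by (simp add: AL)
  moreover have "L \<noteq> 0"
    using AL A0 by (metis fps_nth_Abs_fps fps_zero_nth zero_neq_one)
  ultimately have FW: "F = - W" using mult_right_cancel by blast
  have S_eq: "S r = - (\<Sum>i<D. w i ^ r)" if "r > 0" for r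
  proof -
    have "fps_nth F r = fps_nth (- W) r" by (simp only: FW)
    thus ?thesis using that by (simp add: F_def W_def)
  qed
  moreover have "A 1 = S 1" using rec[of 1] A0 by simp
  ultimately show ?thesis using that[of w] by simp
qed

section \<open>Weil's bound for products of linear factors\<close>

definition evaluation_char :: "'a::field set \<Rightarrow> 'a poly \<Rightarrow> int" where
  "evaluation_char C f = (\<Prod>c\<in>C. quad_char (poly f c))"

lemma evaluation_char_1: "evaluation_char C (1 :: 'a::field poly) = 1"
  by (simp add: evaluation_char_def)

lemma evaluation_char_mult:
  fixes f g :: "'a::odd_prime_card mod_ring poly"
  shows "evaluation_char C (f * g) = evaluation_char C f * evaluation_char C g"
  by (simp add: evaluation_char_def quad_char_mult prod.distrib)

text \<open>
  For degree at least \<open>card C\<close>, adding a multiple of a Lagrange basis polynomial changes the value at one point \<open>c0\<close>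
  without changing the other values or the leading term. Multiplying the value at \<open>c0\<close> by a nonsquare \<open>z\<close> permutes
  the monic polynomials and reverses the sign of every term.
\<close>

lemma char_sum_evaluation_char_eq_0:
  fixes C :: "'a::odd_prime_card mod_ring set"
  assumes "C \<noteq> {}" "n \<ge> card C"
  shows "char_sum (evaluation_char C) n = 0"
proof -
  obtain c0 where c0: "c0 \<in> C" using assms by blast
  obtain z :: "'a mod_ring" where z: "quad_char z = - 1" using exists_nonsquare by blast
  hence z0: "z \<noteq> 0" by auto
  define \<kappa> where "\<kappa> = (\<Prod>c\<in>C - {c0}. c0 - c)"
  have \<kappa>: "\<kappa> \<noteq> 0" by (auto simp: \<kappa>_def)
  define \<eta> where "\<eta> = smult (inverse \<kappa>) (\<Prod>c\<in>C - {c0}. [:- c, 1:])"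
  have \<eta>_eval: "poly \<eta> c = (if c = c0 then 1 else 0)" if "c \<in> C" for c
    using that \<kappa> by (auto simp: \<eta>_def poly_prod \<kappa>_def intro!: prod_zero)
  have "degree (\<Prod>c\<in>C - {c0}. [:- c, 1:]) = card C - 1"
    using c0 by (subst degree_prod_eq_sum_degree) auto
  moreover have "card C > 0" using c0 by (auto simp: card_gt_0_iff)
  ultimately have \<eta>_deg: "degree \<eta> < n"
    using assms(2) degree_smult_le[of "inverse \<kappa>" "\<Prod>c\<in>C - {c0}. [:- c, 1:]"]
    by (simp add: \<eta>_def)
  \<comment> \<open>\<open>T w\<close> multiplies the value at \<open>c0\<close> by \<open>w\<close>.\<close>
  define T where "T = (\<lambda>w f. f + smult ((w - 1) * poly f c0) \<eta>)"
  have T_eval: "poly (T w f) c = (if c = c0 then w * poly f c0 else poly f c)" if "c \<in> C" for w f c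
    using \<eta>_eval[OF that] by (simp add: T_def algebra_simps)
  have T_monic: "T w f \<in> monics n" if "f \<in> monics n" for w f
  proof -
    have f: "degree f = n" "lead_coeff f = 1" using that by (auto simp: monics_def)
    have less: "degree (smult ((w - 1) * poly f c0) \<eta>) < degree f"
      using \<eta>_deg f(1) by (intro le_less_trans[OF degree_smult_le]) simp
    hence "degree (T w f) = n"
      using f(1) by (simp add: T_def degree_add_eq_left)
    moreover have "Polynomial.coeff (T w f) n = 1"
      using f less \<eta>_deg by (simp add: T_def coeff_eq_0)
    ultimately show ?thesis by (simp add: monics_def)
  qed
  have T_inv: "T (inverse w) (T w f) = f" if "w \<noteq> 0" for w f
  proof -
    have "T (inverse w) (T w f) = T w f + smult ((inverse w - 1) * poly (T w f) c0) \<eta>"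
      by (simp add: T_def)
    also have "poly (T w f) c0 = w * poly f c0" using T_eval[OF c0] by simp
    also have "T w f + smult ((inverse w - 1) * (w * poly f c0)) \<eta>
        = f + smult ((w - 1) * poly f c0 + (inverse w - 1) * (w * poly f c0)) \<eta>"
      by (simp add: T_def smult_add_left)
    also have "(w - 1) * poly f c0 + (inverse w - 1) * (w * poly f c0) = 0"
      using that by (simp add: field_simps)
    finally show ?thesis by simp
  qed
  have ec: "evaluation_char C (T z f) = - evaluation_char C f" for f
  proof -
    have "evaluation_char C (T z f) = quad_char (poly (T z f) c0) * (\<Prod>c\<in>C - {c0}. quad_char (poly (T z f) c))"
      unfolding evaluation_char_def using c0 by (subst prod.remove[of C c0]) auto
    also have "quad_char (poly (T z f) c0) = - quad_char (poly f c0)"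
      using T_eval[OF c0] z by (simp add: quad_char_mult)
    also have "(\<Prod>c\<in>C - {c0}. quad_char (poly (T z f) c)) = (\<Prod>c\<in>C - {c0}. quad_char (poly f c))"
      by (intro prod.cong refl) (auto simp: T_eval)
    also have "- quad_char (poly f c0) * (\<Prod>c\<in>C - {c0}. quad_char (poly f c)) = - evaluation_char C f"
      using c0 prod.remove[of C c0 "\<lambda>c. quad_char (poly f c)"] by (simp add: evaluation_char_def)
    finally show ?thesis .
  qed
  have "char_sum (evaluation_char C) n = (\<Sum>f\<in>monics n. evaluation_char C (T z f))"
    unfolding char_sum_def
  proof (rule sum.reindex_bij_witness[where i = "T z" and j = "T (inverse z)"])
    fix f :: "'a mod_ring poly" assume f: "f \<in> monics n"
    show "T z (T (inverse z) f) = f" using T_inv[of "inverse z" f] z0 by simp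
    thus "evaluation_char C (T z (T (inverse z) f)) = evaluation_char C f" by simp
    show "T (inverse z) f \<in> monics n" by (rule T_monic[OF f])
    show "T z f \<in> monics n" by (rule T_monic[OF f])
    show "T (inverse z) (T z f) = f" by (rule T_inv[OF z0])
  qed
  also have "\<dots> = - char_sum (evaluation_char C) n"
    by (simp add: ec char_sum_def sum_negf)
  finally show ?thesis by simp
qed

lemma char_sum_evaluation_char_1:
  fixes C :: "'a::odd_prime_card mod_ring set"
  shows "char_sum (evaluation_char C) 1 =
    quad_char (- 1 :: 'a mod_ring) ^ card C * (\<Sum>u\<in>UNIV. \<Prod>c\<in>C. quad_char (u - c))"
proof -
  have m1: "monics 1 = (\<lambda>u. [:- u, 1:]) ` (UNIV :: 'a mod_ring set)"
  proof (intro equalityI subsetI)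
    fix f :: "'a mod_ring poly" assume "f \<in> monics 1"
    hence f: "degree f = 1" "Polynomial.coeff f 1 = 1" by (auto simp: monics_def)
    obtain a r where ar: "f = pCons a r" by (cases f)
    have "degree r = 0" using f(1) ar by (auto split: if_splits)
    then obtain b where "r = [:b:]" by (auto elim: degree_eq_zeroE)
    hence "f = [:- (- a), 1:]" using ar f(2) by simp
    thus "f \<in> range (\<lambda>u. [:- u, 1:])" by blast
  qed (auto simp: monics_def)
  have "char_sum (evaluation_char C) 1 = (\<Sum>u\<in>UNIV. evaluation_char C [:- u, 1:])"
    unfolding char_sum_def m1 by (subst sum.reindex) (auto simp: inj_on_def)
  also have "\<dots> = (\<Sum>u\<in>UNIV. quad_char (- 1 :: 'a mod_ring) ^ card C * (\<Prod>c\<in>C. quad_char (u - c)))"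
  proof (rule sum.cong[OF refl])
    fix u :: "'a mod_ring"
    have "quad_char (poly [:- u, 1:] c) = quad_char (- 1 :: 'a mod_ring) * quad_char (u - c)" for c
      by (simp flip: quad_char_mult)
    thus "evaluation_char C [:- u, 1:] = quad_char (- 1 :: 'a mod_ring) ^ card C * (\<Prod>c\<in>C. quad_char (u - c))"
      by (simp only: evaluation_char_def prod.distrib prod_constant)
  qed
  finally show ?thesis by (simp add: sum_distrib_left)
qed

lemma mangoldt_sum_as_prime_sum:
  fixes \<psi> :: "'a::field_gcd poly \<Rightarrow> int"
  shows "mangoldt_sum \<psi> n = (\<Sum>p | prime p \<and> degree p dvd n.
           int (degree p) * \<psi> p ^ (n div degree p))"
  unfolding mangoldt_sum_def
proof (rule sum.reindex_bij_witness[where i = "\<lambda>p. (p, n div degree p)" and j = fst])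
  fix x :: "'a poly \<times> nat" assume "x \<in> prime_powers_of_degree n"
  then obtain p k where x: "x = (p, k)" "prime p" "degree p * k = n"
    by (auto simp: prime_powers_of_degree_def)
  have k: "n div degree p = k"
    using prime_poly_monic(2)[OF x(2)] by (simp add: x(3)[symmetric])
  show "(fst x, n div degree (fst x)) = x" by (simp add: x(1) k)
  show "fst x \<in> {p. prime p \<and> degree p dvd n}"
    using x(2) by (simp add: x(1) x(3)[symmetric])
  show "int (degree (fst x)) * \<psi> (fst x) ^ (n div degree (fst x))
      = (case x of (p, k) \<Rightarrow> int (degree p) * \<psi> p ^ k)"
    by (simp add: x(1) k)
qed (simp_all add: prime_powers_of_degree_def)

text \<open>
  Stepanov's method only gives upper bounds, for the primes with symbol \<open>1\<close> and for those with
  symbol \<open>-1\<close>. But the total over all primes is exactly \<open>P\<^sup>2\<close>, and primes with symbol \<open>0\<close> are linear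
  factors \<open>X - c\<close>. So both classes have weight \<open>P\<^sup>2 / 2 + O(P)\<close>, and their difference is small.
\<close>

lemma mangoldt_sum_evaluation_char_bound:
  fixes C :: "'a::odd_prime_card mod_ring set"
  assumes d: "card C = 2 * g + 1" and t: "CARD('a) ^ t \<ge> 4 * g + 5"
  shows "\<bar>mangoldt_sum (evaluation_char C) (2 * t)\<bar> \<le> int (5 * card C * CARD('a) ^ t)"
proof -
  let ?\<psi> = "evaluation_char C"
  define P where "P = CARD('a) ^ t"
  define n where "n = 2 * t"
  define D where "D = {p :: 'a mod_ring poly. prime p \<and> degree p dvd n}"
  define N where "N = (\<lambda>\<epsilon>. \<Sum>p\<in>{p\<in>D. ?\<psi> p ^ (n div degree p) = \<epsilon>}. degree p)"
  define f where "f = (\<Prod>c\<in>C. [:- c, 1:])"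
  have "t > 0" using t by (cases t) auto
  hence n0: "n > 0" "even n" by (auto simp: n_def)
  have finD: "finite D"
    by (rule finite_subset[OF _ finite_degree_less[of "Suc n"]])
       (use n0 in \<open>auto simp: D_def less_Suc_eq_le dest: dvd_imp_le\<close>)
  have deg_f: "degree f = 2 * g + 1"
    unfolding f_def by (subst degree_prod_eq_sum_degree) (auto simp: d)
  have "odd P" using odd_card[where 'a='a] by (simp add: P_def)
  then obtain h where h: "P = 2 * h + 1" by (rule oddE)
  have hg: "h \<ge> 2 * g + 2" using t h unfolding P_def[symmetric] by linarith
  have P2: "P ^ 2 = CARD('a) ^ n" by (simp add: P_def n_def mult.commute flip: power_mult)
  have sgn: "?\<psi> p ^ k \<in> {0, 1, -1}" for p k
  proof -
    have "\<bar>?\<psi> p\<bar> \<le> 1"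
      unfolding evaluation_char_def abs_prod by (intro prod_le_1) (auto simp: abs_quad_char_le_1)
    hence "\<bar>?\<psi> p ^ k\<bar> \<le> 1" unfolding power_abs by (intro power_le_one) auto
    hence "?\<psi> p ^ k = 0 \<or> ?\<psi> p ^ k = 1 \<or> ?\<psi> p ^ k = - 1" by linarith
    thus ?thesis by (metis insertI1 insertI2)
  qed
  have euler: "[f ^ ((P ^ 2 - 1) div 2) = [:of_int (?\<psi> p ^ (n div degree p)):]] (mod p)"
    if "p \<in> D" for p
  proof -
    let ?k = "n div degree p"
    have p: "prime p" "degree p * ?k = n" using that by (auto simp: D_def)
    have "[(\<Prod>c\<in>C. [:- c, 1:] ^ ((CARD('a) ^ n - 1) div 2)) = (\<Prod>c\<in>C. [:of_int (quad_char (poly p c) ^ ?k):])] (mod p)"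
      by (intro cong_prod linear_euler_cong[OF p n0])
    also have "(\<Prod>c\<in>C. [:- c, 1:] ^ ((CARD('a) ^ n - 1) div 2)) = f ^ ((P ^ 2 - 1) div 2)"
      by (simp only: f_def P2 prod_power_distrib)
    also have "(\<Prod>c\<in>C. [:of_int (quad_char (poly p c) ^ ?k):]) = [:\<Prod>c\<in>C. of_int (quad_char (poly p c) ^ ?k):]"
      by (induction C rule: infinite_finite_induct) (auto simp: one_pCons mult.commute)
    also have "(\<Prod>c\<in>C. of_int (quad_char (poly p c) ^ ?k)) = (of_int (?\<psi> p ^ ?k) :: 'a mod_ring)"
      by (simp only: evaluation_char_def of_int_prod[symmetric] prod_power_distrib)
    finally show ?thesis .
  qed
  have N_le: "2 * N \<epsilon> \<le> P ^ 2 + 4 * card C * P" for \<epsilon>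
    unfolding N_def d
  proof (rule stepanov_bound[OF deg_f P_def h hg, where \<epsilon> = "of_int \<epsilon>"])
    show "finite {p \<in> D. ?\<psi> p ^ (n div degree p) = \<epsilon>}" using finD by simp
    fix p assume "p \<in> {p \<in> D. ?\<psi> p ^ (n div degree p) = \<epsilon>}"
    hence p: "p \<in> D" "?\<psi> p ^ (n div degree p) = \<epsilon>" by auto
    show "prime p" using p(1) by (simp add: D_def)
    have "degree p * (n div degree p) = n" using p(1) by (simp add: D_def)
    thus "[Polynomial.monom 1 (P ^ 2) = Polynomial.monom 1 1] (mod p)"
      unfolding P2 by (rule monom_frobenius_cong[OF \<open>prime p\<close>])
    show "[f ^ ((P ^ 2 - 1) div 2) = [:of_int \<epsilon>:]] (mod p)"
      using euler[OF p(1)] p(2) by simp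
  qed
  have "N 0 \<le> card C"
  proof -
    have sub: "{p\<in>D. ?\<psi> p ^ (n div degree p) = 0} \<subseteq> (\<lambda>c. [:- c, 1:]) ` C"
    proof
      fix p assume p: "p \<in> {p\<in>D. ?\<psi> p ^ (n div degree p) = 0}"
      hence "prime p" "?\<psi> p = 0" by (auto simp: D_def)
      then obtain c where c: "c \<in> C" "poly p c = 0"
        by (auto simp: evaluation_char_def)
      have "p dvd [:- c, 1:]" using prime_poly_dvd_linear_iff[OF \<open>prime p\<close>] c by blast
      moreover have "[:- c, 1:] dvd p" using c by (simp add: poly_eq_0_iff_dvd)
      ultimately have "normalize p = normalize [:- c, 1:]" by (rule associatedI)
      moreover have "normalize p = p" using \<open>prime p\<close> by (rule normalize_prime)
      moreover have "normalize [:- c, 1:] = [:- c, 1:]"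
        by (simp add: normalize_poly_eq_map_poly map_poly_pCons)
      ultimately show "p \<in> (\<lambda>c. [:- c, 1:]) ` C" using c by auto
    qed
    have "N 0 \<le> (\<Sum>p\<in>(\<lambda>c. [:- c, 1:]) ` C. degree p)"
      unfolding N_def by (rule sum_mono2[OF _ sub]) auto
    also have "\<dots> = card C"
      by (subst sum.reindex) (auto simp: inj_on_def)
    finally show ?thesis .
  qed
  have split: "(\<Sum>p\<in>D. int (degree p) * w (?\<psi> p ^ (n div degree p)))
      = int (N 1) * w 1 + int (N (- 1)) * w (- 1) + int (N 0) * w 0" for w :: "int \<Rightarrow> int"
  proof -
    let ?D = "\<lambda>\<epsilon>. {p\<in>D. ?\<psi> p ^ (n div degree p) = \<epsilon>}"
    have im: "(\<lambda>p. ?\<psi> p ^ (n div degree p)) ` D \<subseteq> {1, -1, 0}"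
      using sgn by blast
    have "(\<Sum>p\<in>D. int (degree p) * w (?\<psi> p ^ (n div degree p)))
       = (\<Sum>\<epsilon>\<in>{1, -1, 0}. \<Sum>p\<in>?D \<epsilon>. int (degree p) * w (?\<psi> p ^ (n div degree p)))"
      by (rule sum.group[OF finD _ im, symmetric]) simp
    also have "\<dots> = (\<Sum>\<epsilon>\<in>{1, -1, 0}. int (N \<epsilon>) * w \<epsilon>)"
      by (intro sum.cong refl) (simp add: N_def sum_distrib_right)
    finally show ?thesis by simp
  qed
  have "mangoldt_sum ?\<psi> n = int (N 1) - int (N (- 1))"
    using split[of "\<lambda>x. x"] mangoldt_sum_as_prime_sum[of ?\<psi> n] by (simp add: D_def)
  moreover have "int (P ^ 2) = int (N 1) + int (N (- 1)) + int (N 0)"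
    using split[of "\<lambda>x. 1"] mangoldt_sum_as_prime_sum[of "\<lambda>_ :: 'a mod_ring poly. 1" n]
      mangoldt_sum_trivial[OF n0(1), where 'a="'a mod_ring"] by (simp add: D_def P2)
  moreover have "P \<ge> 1" using t by (simp add: P_def)
  hence "card C \<le> card C * P" by simp
  ultimately show ?thesis
    using N_le[of 1] N_le[of "- 1"] \<open>N 0 \<le> card C\<close>
    unfolding n_def[symmetric] P_def[symmetric] by linarith
qed

text \<open>
  The estimate at degree \<open>2 t\<close> concerns the power sums of the squares of the inverse roots, and shows that each inverse root
  has modulus at most \<open>\<surd>q\<close>. The oddness of \<open>card C\<close> is the parity condition of
  Stepanov's method.
\<close>

lemma weil_bound_odd:
  fixes C :: "'a::odd_prime_card mod_ring set"
  assumes "odd (card C)"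
  shows "\<bar>real_of_int (\<Sum>u\<in>UNIV. \<Prod>c\<in>C. quad_char (u - c))\<bar> \<le> (real (card C) - 1) * sqrt (real CARD('a))"
proof -
  let ?\<psi> = "evaluation_char C" and ?q = "CARD('a)"
  from assms obtain g where g: "card C = 2 * g + 1" by (rule oddE)
  have C: "C \<noteq> {}" using g by auto
  define A where "A = (\<lambda>n. of_int (char_sum ?\<psi> n) :: complex)"
  define S where "S = (\<lambda>n. of_int (mangoldt_sum ?\<psi> n) :: complex)"
  have A0: "A 0 = 1" by (simp add: A_def char_sum_def monics_0 evaluation_char_1)
  have A_van: "A n = 0" if "n > 2 * g" for n
    using char_sum_evaluation_char_eq_0[OF C, of n] that by (simp add: A_def g)
  have rec: "of_nat r * A r = (\<Sum>s\<in>{1..r}. S s * A (r - s))" for r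
  proof -
    have "of_int (int r * char_sum ?\<psi> r) = (of_int (\<Sum>s\<in>{1..r}. mangoldt_sum ?\<psi> s * char_sum ?\<psi> (r - s)) :: complex)"
      by (simp only: log_derivative_identity[OF evaluation_char_1 evaluation_char_mult])
    thus ?thesis by (simp add: A_def S_def)
  qed
  obtain w where A1: "A 1 = - (\<Sum>i<2 * g. w i)" and S_eq: "\<And>r. r > 0 \<Longrightarrow> S r = - (\<Sum>i<2 * g. w i ^ r)"
    using newton_inverse_roots[OF A0 A_van rec] by blast
  have w_le: "norm (w i) \<le> sqrt ?q" if i: "i < 2 * g" for i
  proof -
    have "norm ((w i)\<^sup>2) \<le> real ?q"
    proof (rule norm_le_of_power_sums_bounded[where z = "\<lambda>i. (w i)\<^sup>2" and I = "{..<2 * g}" and N = "4 * g + 5" and K = "real (5 * card C)"])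
      fix t assume t: "t \<ge> 4 * g + 5"
      \<comment> \<open>Stepanov's method needs \<open>q\<^sup>t\<close> to be large compared with the number of factors.\<close>
      have "4 * g + 5 \<le> 2 ^ t" using t less_exp[of t] by linarith
      also have "(2::nat) ^ t \<le> ?q ^ t" using card_ge_3[where 'a='a] by (intro power_mono) auto
      finally have "\<bar>mangoldt_sum ?\<psi> (2 * t)\<bar> \<le> int (5 * card C * ?q ^ t)"
        by (rule mangoldt_sum_evaluation_char_bound[OF g])
      hence "real_of_int \<bar>mangoldt_sum ?\<psi> (2 * t)\<bar> \<le> real_of_int (int (5 * card C * ?q ^ t))"
        by (rule of_int_le_iff[THEN iffD2])
      hence "norm (S (2 * t)) \<le> real (5 * card C) * real ?q ^ t"
        by (simp add: S_def)
      moreover have "S (2 * t) = - (\<Sum>i<2 * g. (w i)\<^sup>2 ^ t)"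
        using S_eq[of "2 * t"] t by (simp add: power_mult)
      ultimately show "norm (\<Sum>i<2 * g. (w i)\<^sup>2 ^ t) \<le> real (5 * card C) * real ?q ^ t"
        by simp
    qed (use i card_ge_3[where 'a='a] in auto)
    thus ?thesis by (simp add: norm_power real_le_rsqrt)
  qed
  have "norm (A 1) \<le> (\<Sum>i<2 * g. sqrt ?q)"
    unfolding A1 norm_minus_cancel by (rule sum_norm_le) (use w_le in auto)
  moreover have "norm (A 1) = \<bar>real_of_int (\<Sum>u\<in>UNIV. \<Prod>c\<in>C. quad_char (u - c))\<bar>"
  proof -
    have "\<bar>quad_char (- 1 :: 'a mod_ring)\<bar> = 1" by (simp add: quad_char_def)
    hence "\<bar>char_sum ?\<psi> 1\<bar> = \<bar>\<Sum>u\<in>UNIV. \<Prod>c\<in>C. quad_char (u - c)\<bar>"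
      unfolding char_sum_evaluation_char_1 abs_mult power_abs by simp
    hence "real_of_int \<bar>char_sum ?\<psi> 1\<bar> = real_of_int \<bar>\<Sum>u\<in>UNIV. \<Prod>c\<in>C. quad_char (u - c)\<bar>"
      by (rule arg_cong)
    thus ?thesis unfolding A_def norm_of_int by (simp only: of_int_abs)
  qed
  ultimately show ?thesis by (simp add: g)
qed

text \<open>
  If \<open>card C\<close> is even, the substitution \<open>u = c0 + 1 / v\<close> moves the root \<open>c0\<close> to infinity. This leaves an odd number of
  factors and costs one term of modulus at most \<open>1\<close>, from \<open>v = 0\<close>.
\<close>

theorem weil_bound:
  fixes C :: "'a::odd_prime_card mod_ring set"
  assumes "C \<noteq> {}"
  shows "\<bar>real_of_int (\<Sum>u\<in>UNIV. \<Prod>c\<in>C. quad_char (u - c))\<bar> \<le> (real (card C) - 1) * sqrt (real CARD('a))"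
proof (cases "odd (card C)")
  case True
  thus ?thesis by (rule weil_bound_odd)
next
  case False
  obtain c0 where c0: "c0 \<in> C" using assms by blast
  define D where "D = (\<lambda>c. inverse (c - c0)) ` (C - {c0})"
  have inj: "inj_on (\<lambda>c. inverse (c - c0)) (C - {c0})"
    by (auto simp: inj_on_def)
  have cardD: "card D = card C - 1"
    unfolding D_def card_image[OF inj] using c0 by simp
  have C1: "card C \<ge> 1" using c0 by (simp add: Suc_le_eq card_gt_0_iff) auto
  with False have C2: "card C \<ge> 2" by presburger
  have oddD: "odd (card D)" unfolding cardD using False C1 by presburger
  define \<sigma> where "\<sigma> = (\<Prod>c\<in>C - {c0}. quad_char (c0 - c))"
  let ?W = "\<lambda>v. \<Prod>\<delta>\<in>D. quad_char (v - \<delta>)"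
  have sub: "(\<Prod>c\<in>C. quad_char (c0 + inverse v - c)) = \<sigma> * ?W v" if v: "v \<noteq> 0" for v
  proof -
    have "(\<Prod>c\<in>C. quad_char (c0 + inverse v - c)) = quad_char (inverse v) * (\<Prod>c\<in>C - {c0}. quad_char (c0 + inverse v - c))"
      using c0 by (subst prod.remove[of C c0]) auto
    also have "(\<Prod>c\<in>C - {c0}. quad_char (c0 + inverse v - c))
       = (\<Prod>c\<in>C - {c0}. quad_char v * (quad_char (c0 - c) * quad_char (v - inverse (c - c0))))"
    proof (intro prod.cong refl)
      fix c assume c: "c \<in> C - {c0}"
      have "(c - c0) * inverse (c - c0) = 1" using c by (intro right_inverse) auto
      hence "(c0 - c) * (v - inverse (c - c0)) = (c0 - c) * v + 1"
        by (simp add: algebra_simps)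
      hence "inverse v * ((c0 - c) * (v - inverse (c - c0))) = (inverse v * v) * (c0 - c) + inverse v"
        by (simp add: algebra_simps)
      also have "\<dots> = c0 + inverse v - c" using v by simp
      finally have "quad_char (c0 + inverse v - c) = quad_char (inverse v * ((c0 - c) * (v - inverse (c - c0))))"
        by (rule arg_cong[OF sym])
      thus "quad_char (c0 + inverse v - c) = quad_char v * (quad_char (c0 - c) * quad_char (v - inverse (c - c0)))"
        by (simp add: quad_char_mult quad_char_inverse)
    qed
    also have "\<dots> = quad_char v ^ (card C - 1) * (\<sigma> * ?W v)"
      using c0 by (simp add: prod.distrib \<sigma>_def D_def prod.reindex[OF inj])
    finally have "(\<Prod>c\<in>C. quad_char (c0 + inverse v - c)) = quad_char v ^ Suc (card C - 1) * (\<sigma> * ?W v)"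
      by (simp add: quad_char_inverse)
    moreover have "quad_char v ^ Suc (card C - 1) = 1"
      using False C1 v by (intro quad_char_even_power) auto
    ultimately show ?thesis by simp
  qed
  have "(\<Sum>u\<in>UNIV. \<Prod>c\<in>C. quad_char (u - c)) = (\<Sum>u\<in>-{c0}. \<Prod>c\<in>C. quad_char (u - c))"
  proof (rule sum.mono_neutral_right)
    show "\<forall>u\<in>UNIV - -{c0}. (\<Prod>c\<in>C. quad_char (u - c)) = 0"
      using c0 by (auto intro!: prod_zero)
  qed auto
  also have "\<dots> = (\<Sum>v\<in>-{0}. \<Prod>c\<in>C. quad_char (c0 + inverse v - c))"
    by (rule sum.reindex_bij_witness[where i = "\<lambda>v. c0 + inverse v" and j = "\<lambda>u. inverse (u - c0)"]) auto
  also have "\<dots> = (\<Sum>v\<in>-{0}. \<sigma> * ?W v)"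
    by (intro sum.cong refl sub) auto
  also have "\<dots> = (\<Sum>v\<in>UNIV. \<sigma> * ?W v) - \<sigma> * ?W 0"
    by (simp add: Compl_eq_Diff_UNIV sum_diff1)
  finally have eq: "(\<Sum>u\<in>UNIV. \<Prod>c\<in>C. quad_char (u - c)) = \<sigma> * (\<Sum>v\<in>UNIV. ?W v) - \<sigma> * ?W 0"
    by (simp add: sum_distrib_left)
  have \<sigma>: "\<bar>\<sigma>\<bar> \<le> 1" unfolding \<sigma>_def abs_prod by (intro prod_le_1) (auto simp: abs_quad_char_le_1)
  have W0: "\<bar>?W 0\<bar> \<le> 1" unfolding abs_prod by (intro prod_le_1) (auto simp: abs_quad_char_le_1)
  have "\<bar>\<Sum>u\<in>UNIV. \<Prod>c\<in>C. quad_char (u - c)\<bar> \<le> \<bar>\<sigma>\<bar> * \<bar>\<Sum>v\<in>UNIV. ?W v\<bar> + \<bar>\<sigma>\<bar> * \<bar>?W 0\<bar>"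
    unfolding eq abs_mult[symmetric] by (rule abs_triangle_ineq4)
  also have "\<dots> \<le> 1 * \<bar>\<Sum>v\<in>UNIV. ?W v\<bar> + 1 * 1"
    using \<sigma> W0 by (intro add_mono mult_mono) auto
  finally have "real_of_int \<bar>\<Sum>u\<in>UNIV. \<Prod>c\<in>C. quad_char (u - c)\<bar> \<le> real_of_int (\<bar>\<Sum>v\<in>UNIV. ?W v\<bar> + 1)"
    by (simp only: of_int_le_iff mult_1 mult_1_right)
  also have "\<dots> \<le> (real (card D) - 1) * sqrt (real CARD('a)) + 1"
    using weil_bound_odd[OF oddD] by simp
  also have "\<dots> \<le> (real (card D) - 1) * sqrt (real CARD('a)) + sqrt (real CARD('a))"
    using card_ge_3[where 'a='a] by simp
  also have "\<dots> = (real (card C) - 1) * sqrt (real CARD('a))"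
    using C2 by (simp add: cardD of_nat_diff algebra_simps)
  finally show ?thesis by simp
qed

section \<open>Counting simultaneous nonsquares\<close>

lemma sum_over_squares:
  fixes g :: "'a::odd_prime_card mod_ring \<Rightarrow> int"
  shows "(\<Sum>s\<in>UNIV. g (s ^ 2)) = (\<Sum>u\<in>UNIV. (1 + quad_char u) * g u)"
proof -
  have "(\<Sum>s\<in>UNIV. g (s ^ 2)) = (\<Sum>u\<in>UNIV. \<Sum>s\<in>{s\<in>UNIV. s ^ 2 = u}. g (s ^ 2))"
    by (rule sum.group[symmetric]) auto
  also have "\<dots> = (\<Sum>u\<in>UNIV. \<Sum>s\<in>{s. s ^ 2 = u}. g u)"
    by (intro sum.cong refl) auto
  also have "\<dots> = (\<Sum>u\<in>UNIV. (1 + quad_char u) * g u)"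
    by (simp add: card_square_roots)
  finally show ?thesis .
qed

text \<open>
  An element \<open>u\<close> has \<open>1 + \<chi>(u)\<close> square roots. So the sum splits into one for \<open>C\<close> and one in
  which the factor \<open>\<chi>(u)\<close> adds the root \<open>0\<close>.
\<close>

lemma weil_bound_squares:
  fixes C :: "'a::odd_prime_card mod_ring set"
  assumes "C \<noteq> {}" "0 \<notin> C"
  shows "\<bar>real_of_int (\<Sum>s\<in>UNIV. \<Prod>c\<in>C. quad_char (s ^ 2 - c))\<bar> \<le> (2 * real (card C) - 1) * sqrt (real CARD('a))"
proof -
  let ?X = "\<Sum>u\<in>UNIV. \<Prod>c\<in>C. quad_char (u - c)"
  let ?Y = "\<Sum>u\<in>UNIV. \<Prod>c\<in>insert 0 C. quad_char (u - c)"
  have "(\<Sum>s\<in>UNIV. \<Prod>c\<in>C. quad_char (s ^ 2 - c)) = ?X + ?Y"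
    using assms(2) sum_over_squares[of "\<lambda>u. \<Prod>c\<in>C. quad_char (u - c)"]
    by (simp add: algebra_simps sum.distrib)
  moreover have "\<bar>real_of_int ?X\<bar> \<le> (real (card C) - 1) * sqrt (real CARD('a))"
    by (rule weil_bound[OF assms(1)])
  moreover have "\<bar>real_of_int ?Y\<bar> \<le> (real (card (insert 0 C)) - 1) * sqrt (real CARD('a))"
    by (rule weil_bound) simp
  moreover have "real (card (insert 0 C)) = real (card C) + 1"
    using assms(2) by simp
  moreover have split: "(2 * real (card C) - 1) * sqrt (real CARD('a))
      = (real (card C) - 1) * sqrt (real CARD('a)) + (real (card C) + 1 - 1) * sqrt (real CARD('a))"
    by (simp add: algebra_simps)
  ultimately show ?thesis
    unfolding split by (simp only: of_int_add)
qed

lemma sum_card_Pow: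
  assumes "finite A"
  shows "2 * (\<Sum>T\<in>Pow A. card T) = card A * 2 ^ card A"
  using assms
proof (induction A rule: finite_induct)
  case (insert x A)
  have inj: "inj_on (insert x) (Pow A)" using insert.hyps by (auto simp: inj_on_def)
  have "(\<Sum>T\<in>Pow (insert x A). card T) = (\<Sum>T\<in>Pow A. card T) + (\<Sum>T\<in>insert x ` Pow A. card T)"
    unfolding Pow_insert using insert.hyps by (intro sum.union_disjoint) auto
  also have "(\<Sum>T\<in>insert x ` Pow A. card T) = (\<Sum>T\<in>Pow A. card (insert x T))"
    by (simp add: sum.reindex[OF inj])
  also have "\<dots> = (\<Sum>T\<in>Pow A. card T + 1)"
    by (intro sum.cong refl) (use insert.hyps in \<open>auto simp: card_insert_if finite_subset\<close>)
  also have "\<dots> = (\<Sum>T\<in>Pow A. card T) + 2 ^ card A"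
    using insert.hyps by (simp only: sum.distrib) (simp add: card_Pow)
  finally show ?case using insert by simp
qed simp

text \<open>
  The product of the \<open>1 - \<chi>(s\<^sup>2 - c)\<close> is \<open>2\<^sup>k\<close> if all \<open>s\<^sup>2 - c\<close> are nonsquares, at most
  \<open>2\<^bsup>k - 1\<^esup>\<close> for the at most \<open>2 k\<close> values of \<open>s\<close> for which some \<open>s\<^sup>2 - c\<close> is zero, and zero otherwise. Expanding it over
  subsets of \<open>C\<close> and summing over \<open>s\<close> leaves \<open>q\<close> plus an error that is bounded subset by subset.
\<close>

theorem card_all_nonsquares_ge:
  fixes C :: "'a::odd_prime_card mod_ring set"
  assumes "0 \<notin> C"
  defines "k \<equiv> card C" and "q \<equiv> CARD('a)"
  shows "real (card {s. \<forall>c\<in>C. quad_char (s ^ 2 - c) = - 1})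
     \<ge> real q / 2 ^ k - (real k - 1 + 1 / 2 ^ k) * sqrt (real q) - real k"
proof -
  define G where "G = {s. \<forall>c\<in>C. quad_char (s ^ 2 - c) = - 1}"
  define Z where "Z = {s. \<exists>c\<in>C. s ^ 2 = c}"
  define W where "W = (\<lambda>T. \<Sum>s\<in>UNIV. \<Prod>c\<in>T. quad_char (s ^ 2 - c :: 'a mod_ring))"
  have cardZ: "card Z \<le> 2 * k"
  proof -
    have "Z = (\<Union>c\<in>C. {s. s ^ 2 = c})" by (auto simp: Z_def)
    hence "card Z \<le> (\<Sum>c\<in>C. card {s. s ^ 2 = c})" by (simp add: card_UN_le)
    also have "\<dots> \<le> (\<Sum>c\<in>C. 2)"
    proof (rule sum_mono)
      fix c :: "'a mod_ring"
      have "quad_char c \<le> 1" by (simp add: quad_char_def)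
      thus "card {s. s ^ 2 = c} \<le> 2" using card_square_roots[of c] by linarith
    qed
    finally show ?thesis by (simp add: k_def mult.commute)
  qed
  have pointwise: "2 * (\<Prod>c\<in>C. 1 - quad_char (s ^ 2 - c)) \<le> 2 * 2 ^ k * of_bool (s \<in> G) + 2 ^ k * of_bool (s \<in> Z)" for s
  proof (cases "s \<in> Z")
    case True
    then obtain c where c: "c \<in> C" "s ^ 2 = c" by (auto simp: Z_def)
    have "k > 0" using c by (auto simp: k_def card_gt_0_iff)
    have "(\<Prod>c\<in>C. 1 - quad_char (s ^ 2 - c)) = (1 - quad_char (s ^ 2 - c)) * (\<Prod>c\<in>C - {c}. 1 - quad_char (s ^ 2 - c))"
      using c(1) by (subst prod.remove[of C c]) auto
    also have "1 - quad_char (s ^ 2 - c) = 1" using c by simp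
    also have "(\<Prod>c\<in>C - {c}. 1 - quad_char (s ^ 2 - c)) \<le> (\<Prod>c\<in>C - {c}. 2)"
      by (rule prod_mono) (auto simp: quad_char_def)
    also have "\<dots> = 2 ^ (k - 1)" using c(1) by (simp add: k_def)
    finally have "2 * (\<Prod>c\<in>C. 1 - quad_char (s ^ 2 - c)) \<le> 2 ^ k"
      using \<open>k > 0\<close> by (simp add: power_eq_if)
    moreover have "quad_char (s ^ 2 - c) \<noteq> - 1" using c by simp
    hence "s \<notin> G" using c(1) unfolding G_def by blast
    ultimately show ?thesis using True by simp
  next
    case False
    show ?thesis
    proof (cases "s \<in> G")
      case True
      hence "(\<Prod>c\<in>C. 1 - quad_char (s ^ 2 - c)) = (\<Prod>c\<in>C. 2)"
        by (intro prod.cong refl) (auto simp: G_def)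
      thus ?thesis using True by (simp add: k_def)
    next
      case notG: False
      then obtain c where c: "c \<in> C" "quad_char (s ^ 2 - c) \<noteq> - 1" by (auto simp: G_def)
      moreover have "quad_char (s ^ 2 - c) \<noteq> 0" using False c by (auto simp: Z_def)
      ultimately have "1 - quad_char (s ^ 2 - c) = 0" using quad_char_cases[of "s ^ 2 - c"] by auto
      hence zero: "(\<Prod>c\<in>C. 1 - quad_char (s ^ 2 - c)) = 0"
        using c(1) by (intro prod_zero) auto
      show ?thesis unfolding zero by simp
    qed
  qed
  have "2 * (\<Sum>s\<in>UNIV. \<Prod>c\<in>C. 1 - quad_char (s ^ 2 - c))
      \<le> (\<Sum>s\<in>UNIV. 2 * 2 ^ k * of_bool (s \<in> G) + 2 ^ k * of_bool (s \<in> Z))"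
    unfolding sum_distrib_left by (intro sum_mono pointwise)
  also have "\<dots> = 2 * 2 ^ k * int (card G) + 2 ^ k * int (card Z)"
    by (simp add: sum.distrib sum_distrib_left[symmetric] of_bool_def sum.If_cases)
  also have "\<dots> \<le> 2 * 2 ^ k * int (card G) + 2 ^ k * (2 * int k)"
    using cardZ by (intro add_left_mono mult_left_mono) auto
  finally have upper: "(\<Sum>s\<in>UNIV. \<Prod>c\<in>C. 1 - quad_char (s ^ 2 - c)) \<le> 2 ^ k * (int (card G) + int k)"
    by (simp add: algebra_simps)
  have "(\<Sum>s\<in>UNIV. \<Prod>c\<in>C. 1 - quad_char (s ^ 2 - c)) = (\<Sum>T\<in>Pow C. (- 1) ^ card T * W T)"
  proof -
    have "(\<Prod>c\<in>C. 1 - quad_char (s ^ 2 - c)) = (\<Sum>T\<in>Pow C. (- 1) ^ card T * (\<Prod>c\<in>T. quad_char (s ^ 2 - c)))" for s :: "'a mod_ring"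
    proof -
      have "(\<Prod>c\<in>C. - quad_char (s ^ 2 - c) + 1) = (\<Sum>T\<in>Pow C. (\<Prod>c\<in>T. - quad_char (s ^ 2 - c)) * (\<Prod>c\<in>C - T. 1))"
        by (rule prod_add) simp
      thus ?thesis by (simp add: prod_uminus)
    qed
    thus ?thesis unfolding W_def sum_distrib_left by (simp only:) (rule sum.swap)
  qed
  also have "Pow C = insert {} (Pow C - {{}})" by auto
  also have "(\<Sum>T\<in>insert {} (Pow C - {{}}). (- 1) ^ card T * W T) = W {} + (\<Sum>T\<in>Pow C - {{}}. (- 1) ^ card T * W T)"
    by (subst sum.insert) auto
  also have "W {} = int q" by (simp add: W_def q_def)
  finally have expand: "(\<Sum>s\<in>UNIV. \<Prod>c\<in>C. 1 - quad_char (s ^ 2 - c)) = int q + (\<Sum>T\<in>Pow C - {{}}. (- 1) ^ card T * W T)" .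
  have "\<bar>real_of_int (\<Sum>T\<in>Pow C - {{}}. (- 1) ^ card T * W T)\<bar> \<le> (\<Sum>T\<in>Pow C - {{}}. (2 * real (card T) - 1) * sqrt q)"
    unfolding of_int_sum
  proof (rule order_trans[OF sum_abs sum_mono])
    fix T assume "T \<in> Pow C - {{}}"
    hence "T \<noteq> {}" "0 \<notin> T" using assms(1) by auto
    from weil_bound_squares[OF this]
    show "\<bar>real_of_int ((- 1) ^ card T * W T)\<bar> \<le> (2 * real (card T) - 1) * sqrt q"
      unfolding of_int_mult abs_mult W_def q_def by (simp add: power_abs)
  qed
  also have "(\<Sum>T\<in>Pow C - {{}}. (2 * real (card T) - 1) * sqrt q) = (real k * 2 ^ k - 2 ^ k + 1) * sqrt q"
  proof -
    have "real (2 * (\<Sum>T\<in>Pow C. card T)) = real (card C * 2 ^ card C)"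
      using sum_card_Pow[of C] by (simp only: finite)
    hence "(\<Sum>T\<in>Pow C. 2 * real (card T) - 1) = real k * 2 ^ k - 2 ^ k"
      by (simp add: sum_subtractf sum_distrib_left[symmetric] card_Pow k_def)
    moreover have "(\<Sum>T\<in>Pow C - {{}}. 2 * real (card T) - 1) = (\<Sum>T\<in>Pow C. 2 * real (card T) - 1) + 1"
      by (subst sum_diff1) auto
    ultimately show ?thesis by (simp add: sum_distrib_right[symmetric])
  qed
  finally have err: "\<bar>real_of_int (\<Sum>T\<in>Pow C - {{}}. (- 1) ^ card T * W T)\<bar> \<le> (real k * 2 ^ k - 2 ^ k + 1) * sqrt q" .
  have "real_of_int (int q + (\<Sum>T\<in>Pow C - {{}}. (- 1) ^ card T * W T)) \<le> real_of_int (2 ^ k * (int (card G) + int k))"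
    using upper unfolding expand by (rule of_int_le_iff[THEN iffD2])
  hence "real q - (real k * 2 ^ k - 2 ^ k + 1) * sqrt q \<le> 2 ^ k * (real (card G) + real k)"
    using err by (simp only: of_int_add of_int_mult of_int_power of_int_of_nat_eq of_int_numeral)
  hence "(real q - (real k * 2 ^ k - 2 ^ k + 1) * sqrt q) / 2 ^ k \<le> real (card G) + real k"
    by (simp add: pos_divide_le_eq mult.commute)
  moreover have "(real q - (real k * 2 ^ k - 2 ^ k + 1) * sqrt q) / 2 ^ k
      = real q / 2 ^ k - (real k - 1 + 1 / 2 ^ k) * sqrt q"
    by (simp add: field_simps)
  ultimately show ?thesis unfolding G_def by linarith
qed

text \<open>
  The count in terms of integers modulo \<open>l\<close>, so that \<open>l\<close> can vary within a formula.
\<close>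

definition nonsquare_count_bound :: "nat \<Rightarrow> bool" where
  "nonsquare_count_bound l \<longleftrightarrow> (\<forall>C\<subseteq>{1..<int l}.
     real (card {s\<in>{0..<int l}. \<forall>c\<in>C. \<not> QuadRes (int l) (s ^ 2 - c)})
       \<ge> real l / 2 ^ card C - (real (card C) - 1 + 1 / 2 ^ card C) * sqrt (real l) - real (card C))"

lemma of_int_mod_ring_eq_iff:
  "(of_int x :: 'a::prime_card mod_ring) = of_int y \<longleftrightarrow> [x = y] (mod int CARD('a))"
proof -
  have "(of_int x :: 'a mod_ring) = of_int y \<longleftrightarrow> (of_int (x - y) :: 'a mod_ring) = 0" by simp
  also have "\<dots> \<longleftrightarrow> int CARD('a) dvd x - y"
    by (simp only: of_int_eq_0_iff_char_dvd semiring_char_mod_ring)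
  finally show ?thesis by (simp add: cong_iff_dvd_diff)
qed

lemma bij_betw_of_int_mod_ring:
  "bij_betw of_int {0..<int CARD('a)} (UNIV :: 'a::prime_card mod_ring set)"
proof -
  have inj: "inj_on (of_int :: int \<Rightarrow> 'a mod_ring) {0..<int CARD('a)}"
    by (auto simp: inj_on_def of_int_mod_ring_eq_iff cong_def)
  moreover have "of_int ` {0..<int CARD('a)} = (UNIV :: 'a mod_ring set)"
    using card_image[OF inj] by (intro card_subset_eq) auto
  ultimately show ?thesis by (simp add: bij_betw_def)
qed

lemma QuadRes_iff_quad_char:
  "QuadRes (int CARD('a)) x \<longleftrightarrow> quad_char (of_int x :: 'a::odd_prime_card mod_ring) \<noteq> - 1"
proof -
  have "QuadRes (int CARD('a)) x \<longleftrightarrow> (\<exists>y. (of_int y :: 'a mod_ring) ^ 2 = of_int x)"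
    unfolding QuadRes_def of_int_power[symmetric] of_int_mod_ring_eq_iff ..
  also have "\<dots> \<longleftrightarrow> (\<exists>z. z ^ 2 = (of_int x :: 'a mod_ring))"
    using bij_betw_of_int_mod_ring[where 'a='a] by (metis bij_betw_imp_surj_on image_iff UNIV_I)
  also have "\<dots> \<longleftrightarrow> quad_char (of_int x :: 'a mod_ring) \<noteq> - 1"
    by (auto simp: quad_char_def) (metis zero_power2)
  finally show ?thesis .
qed

lemma nonsquare_count_bound_card: "nonsquare_count_bound CARD('a::odd_prime_card)"
  unfolding nonsquare_count_bound_def
proof (intro allI impI)
  fix C assume C: "C \<subseteq> {1..<int CARD('a)}"
  let ?l = "int CARD('a)"
  define C' where "C' = (of_int ` C :: 'a mod_ring set)"
  note bij = bij_betw_of_int_mod_ring[where 'a='a]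
  have inj: "inj_on (of_int :: int \<Rightarrow> 'a mod_ring) {0..<?l}"
    using bij by (simp add: bij_betw_def)
  have "C \<subseteq> {0..<?l}" using C by auto
  hence card: "card C' = card C"
    unfolding C'_def by (intro card_image inj_on_subset[OF inj])
  have "0 \<notin> C'"
  proof
    assume "0 \<in> C'"
    then obtain c where c: "c \<in> C" "(of_int c :: 'a mod_ring) = of_int 0" by (auto simp: C'_def)
    hence "c = 0" using inj C by (elim inj_onD) auto
    thus False using c C by auto
  qed
  from card_all_nonsquares_ge[OF this]
  have "real (card {s. \<forall>c\<in>C'. quad_char (s ^ 2 - c) = - 1}) \<ge> real CARD('a) / 2 ^ card C - (real (card C) - 1 + 1 / 2 ^ card C) * sqrt (real CARD('a)) - real (card C)"
    by (simp only: card)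
  also have "card {s. \<forall>c\<in>C'. quad_char (s ^ 2 - c) = - 1} = card {s\<in>{0..<?l}. \<forall>c\<in>C. \<not> QuadRes ?l (s ^ 2 - c)}"
  proof -
    have "bij_betw (of_int :: int \<Rightarrow> 'a mod_ring) {s\<in>{0..<?l}. \<forall>c\<in>C. \<not> QuadRes ?l (s ^ 2 - c)} {s\<in>UNIV. \<forall>c\<in>C'. quad_char (s ^ 2 - c) = - 1}"
      by (rule bij_betw_Collect[OF bij]) (simp add: C'_def QuadRes_iff_quad_char)
    from bij_betw_same_card[OF this] show ?thesis by simp
  qed
  finally show "real CARD('a) / 2 ^ card C - (real (card C) - 1 + 1 / 2 ^ card C) * sqrt (real CARD('a)) - real (card C)
      \<le> real (card {s\<in>{0..<?l}. \<forall>c\<in>C. \<not> QuadRes ?l (s ^ 2 - c)})" .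
qed

text \<open>
  A counterexample to the bound if there is one, so that the bound for this single prime implies the bound for all
  odd primes. The default \<open>3\<close> keeps it an odd prime in the other case.
\<close>

definition generic_odd_prime :: nat where
  "generic_odd_prime = (if \<exists>l. prime l \<and> odd l \<and> \<not> nonsquare_count_bound l
     then SOME l. prime l \<and> odd l \<and> \<not> nonsquare_count_bound l else 3)"

lemma generic_odd_prime: "prime generic_odd_prime" "odd generic_odd_prime"
proof -
  have "prime generic_odd_prime \<and> odd generic_odd_prime"
  proof (cases "\<exists>l. prime l \<and> odd l \<and> \<not> nonsquare_count_bound l")
    case True
    thus ?thesis unfolding generic_odd_prime_def using someI_ex[OF True] by auto
  next
    case False
    thus ?thesis unfolding generic_odd_prime_def if_not_P[OF False] by simp
  qed
  thus "prime generic_odd_prime" "odd generic_odd_prime" by auto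
qed

text \<open>
  The type \<open>generic_index mod_ring\<close> is then the field with \<open>generic_odd_prime\<close> elements.
\<close>

typedef generic_index = "{0..<generic_odd_prime}"
  using prime_gt_0_nat[OF generic_odd_prime(1)] by (intro exI[of _ 0]) auto

lemma card_generic_index: "CARD(generic_index) = generic_odd_prime"
  using type_definition.card[OF type_definition_generic_index] by simp

instance generic_index :: odd_prime_card
  by standard (simp_all add: card_generic_index generic_odd_prime)

theorem nonsquare_count_bound:
  assumes "prime l" "odd l"
  shows "nonsquare_count_bound l"
proof (rule ccontr)
  assume "\<not> nonsquare_count_bound l"
  hence ex: "\<exists>l. prime l \<and> odd l \<and> \<not> nonsquare_count_bound l" using assms by blast
  hence "\<not> nonsquare_count_bound generic_odd_prime"
    using someI_ex[OF ex] by (simp add: generic_odd_prime_def)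
  thus False
    using nonsquare_count_bound_card[where 'a=generic_index] by (simp add: card_generic_index)
qed

section \<open>Hyperbola sets and the sieve\<close>

lemma QuadRes_cong: "[x = y] (mod l) \<Longrightarrow> QuadRes l x \<longleftrightarrow> QuadRes l y"
  unfolding QuadRes_def by (meson cong_trans cong_sym)

lemma residue_ring_inverse:
  assumes "prime l" "x \<in> Units (residue_ring (int l))"
  shows "[x * inv\<^bsub>residue_ring (int l)\<^esub> x = 1] (mod int l)"
proof -
  interpret residues_prime l "residue_ring (int l)"
    by unfold_locales (use assms(1) in auto)
  have "x \<otimes>\<^bsub>residue_ring (int l)\<^esub> inv\<^bsub>residue_ring (int l)\<^esub> x = \<one>\<^bsub>residue_ring (int l)\<^esub>"
    using assms(2) by (rule Units_r_inv)
  moreover have "1 mod int l = 1" using prime_gt_1_nat[OF assms(1)] by simp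
  ultimately show ?thesis
    by (simp add: residue_ring_def cong_def)
qed

lemma Units_residue_ring_prime:
  assumes "prime l"
  shows "Units (residue_ring (int l)) = {1..int l - 1}"
proof -
  interpret residues_prime l "residue_ring (int l)"
    by unfold_locales (use assms in auto)
  show ?thesis
    unfolding res_prime_units_eq using prime_gt_0_nat[OF assms] by (simp add: of_nat_diff)
qed

text \<open>
  If \<open>s = a x + N / x\<close>, then \<open>s\<^sup>2 - 4 a N\<close> is the square of \<open>a x - N / x\<close>.
\<close>

lemma hyperbola_values_discriminant:
  assumes "prime l" "s \<in> hyperbola_values (int l) N a"
  shows "s \<in> {0..<int l}" "QuadRes (int l) (s ^ 2 - 4 * a * N)"
proof -
  let ?R = "residue_ring (int l)"
  from assms(2) obtain x where x: "x \<in> Units ?R"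
    and s: "s = (a \<otimes>\<^bsub>?R\<^esub> x) \<oplus>\<^bsub>?R\<^esub> ((N mod int l) \<otimes>\<^bsub>?R\<^esub> inv\<^bsub>?R\<^esub> x)"
    by (auto simp: hyperbola_values_def)
  define y where "y = inv\<^bsub>?R\<^esub> x"
  have s_eq: "s = (a * x + N * y) mod int l"
    unfolding s y_def[symmetric] by (simp add: residue_ring_def mod_simps)
  show "s \<in> {0..<int l}"
    unfolding s_eq using prime_gt_0_nat[OF assms(1)] by simp
  have xy: "[x * y = 1] (mod int l)"
    unfolding y_def by (rule residue_ring_inverse[OF assms(1) x])
  have s_cong: "[s = a * x + N * y] (mod int l)" by (simp add: s_eq)
  have "[s ^ 2 - 4 * a * N * 1 = (a * x + N * y) ^ 2 - 4 * a * N * (x * y)] (mod int l)"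
    by (intro cong_diff cong_pow cong_mult s_cong cong_refl cong_sym[OF xy])
  also have "(a * x + N * y) ^ 2 - 4 * a * N * (x * y) = (a * x - N * y) ^ 2"
    by (simp add: power2_eq_square algebra_simps)
  finally show "QuadRes (int l) (s ^ 2 - 4 * a * N)"
    unfolding QuadRes_def by (auto intro: cong_sym)
qed

text \<open>
  The constants \<open>4 a\<^sub>j N\<close> are distinct and nonzero modulo \<open>l\<close>, since \<open>l\<close> is odd and does not divide \<open>N\<close>. So
  the counting theorem provides many residues outside the union.
\<close>

theorem card_hyperbola_union_le:
  fixes l k :: nat and a :: "nat \<Rightarrow> int"
  assumes l: "prime l" "odd l" and N: "\<not> int l dvd N"
    and a: "\<And>j. j \<in> {1..k} \<Longrightarrow> a j \<in> Units (residue_ring (int l))" "inj_on a {1..k}"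
  shows "real (card (\<Union>j\<in>{1..k}. hyperbola_values (int l) N (a j)))
    \<le> real l * (1 - 1 / 2 ^ k + (real k - 1 + 1 / 2 ^ k) / sqrt (real l) + real k / real l)"
proof -
  define c where "c = (\<lambda>j. (4 * a j * N) mod int l)"
  define G where "G = {s\<in>{0..<int l}. \<forall>d\<in>c ` {1..k}. \<not> QuadRes (int l) (s ^ 2 - d)}"
  have pl: "prime (int l)" using l(1) by simp
  have l0: "int l > 0" using prime_gt_0_nat[OF l(1)] by simp
  have a_range: "1 \<le> a j" "a j < int l" if "j \<in> {1..k}" for j
    using a(1)[OF that] unfolding Units_residue_ring_prime[OF l(1)] by auto
  have "\<not> int l dvd 2"
    using l prime_ge_2_nat[OF l(1)] by (auto dest!: zdvd_imp_le)
  hence "\<not> int l dvd 2 * 2" using prime_dvd_mult_iff[OF pl] by blast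
  hence four: "\<not> int l dvd 4" by simp
  have c_range: "c j \<in> {1..<int l}" if "j \<in> {1..k}" for j
  proof -
    have "\<not> int l dvd a j" using a_range[OF that] by (auto dest: zdvd_imp_le)
    hence "\<not> int l dvd 4 * a j * N"
      using four N prime_dvd_mult_iff[OF pl] by blast
    hence "c j \<noteq> 0" by (simp add: c_def dvd_eq_mod_eq_0)
    moreover have "0 \<le> c j" "c j < int l" using l0 by (simp_all add: c_def)
    ultimately show ?thesis by simp
  qed
  have "inj_on c {1..k}"
  proof (rule inj_onI)
    fix i j assume ij: "i \<in> {1..k}" "j \<in> {1..k}" "c i = c j"
    hence "int l dvd 4 * a i * N - 4 * a j * N" by (simp add: c_def mod_eq_dvd_iff)
    hence "int l dvd 4 * (a i - a j) * N" by (simp add: algebra_simps)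
    hence "int l dvd a i - a j" using four N prime_dvd_mult_iff[OF pl] by blast
    moreover have "\<bar>a i - a j\<bar> < int l" using a_range[OF ij(1)] a_range[OF ij(2)] by linarith
    ultimately have "a i = a j" using dvd_imp_le_int[of "a i - a j" "int l"] by auto
    thus "i = j" using a(2) ij by (auto dest: inj_onD)
  qed
  hence card_c: "card (c ` {1..k}) = k" by (simp add: card_image)
  have "c ` {1..k} \<subseteq> {1..<int l}" using c_range by blast
  note bound = nonsquare_count_bound[OF l, unfolded nonsquare_count_bound_def, rule_format, OF this]
  have G_ge: "real (card G) \<ge> real l / 2 ^ k - (real k - 1 + 1 / 2 ^ k) * sqrt (real l) - real k"
    using bound unfolding card_c G_def .
  have "(\<Union>j\<in>{1..k}. hyperbola_values (int l) N (a j)) \<subseteq> {0..<int l} - G"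
  proof
    fix s assume "s \<in> (\<Union>j\<in>{1..k}. hyperbola_values (int l) N (a j))"
    then obtain j where j: "j \<in> {1..k}" and s: "s \<in> hyperbola_values (int l) N (a j)" by blast
    have "[s ^ 2 - 4 * a j * N = s ^ 2 - c j] (mod int l)"
      by (intro cong_diff cong_refl) (simp add: c_def)
    hence "QuadRes (int l) (s ^ 2 - c j)"
      using hyperbola_values_discriminant(2)[OF l(1) s] QuadRes_cong by blast
    thus "s \<in> {0..<int l} - G"
      using hyperbola_values_discriminant(1)[OF l(1) s] j by (auto simp: G_def)
  qed
  moreover have G_sub: "G \<subseteq> {0..<int l}" by (auto simp: G_def)
  hence finG: "finite G" by (rule finite_subset) simp
  ultimately have "card (\<Union>j\<in>{1..k}. hyperbola_values (int l) N (a j)) \<le> card ({0..<int l} - G)"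
    by (intro card_mono) auto
  also have "\<dots> = l - card G"
    using card_Diff_subset[OF finG G_sub] by simp
  finally have "card (\<Union>j\<in>{1..k}. hyperbola_values (int l) N (a j)) \<le> l - card G" .
  moreover have "card G \<le> l"
    using card_mono[OF _ G_sub] by simp
  ultimately have "real (card (\<Union>j\<in>{1..k}. hyperbola_values (int l) N (a j))) \<le> real l - real (card G)"
    by linarith
  also have "\<dots> \<le> real l - real l / 2 ^ k + (real k - 1 + 1 / 2 ^ k) * sqrt (real l) + real k"
    using G_ge by linarith
  also have "\<dots> = real l * (1 - 1 / 2 ^ k + (real k - 1 + 1 / 2 ^ k) / sqrt (real l) + real k / real l)"
  proof -
    define B where "B = real k - 1 + 1 / 2 ^ k"
    have "real l * (B / sqrt (real l)) = B * (real l / sqrt (real l))" by simp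
    hence "real l * (B / sqrt (real l)) = B * sqrt (real l)" by (simp only: real_div_sqrt of_nat_0_le_iff)
    moreover have "real l * (real k / real l) = real k" using l0 by simp
    ultimately show ?thesis
      unfolding B_def[symmetric] distrib_left right_diff_distrib by simp
  qed
  finally show ?thesis .
qed

lemma prod_distinct_primes_dvd:
  fixes l :: "'i \<Rightarrow> nat"
  assumes "finite I" "inj_on l I" "\<And>i. i \<in> I \<Longrightarrow> prime (l i)" "\<And>i. i \<in> I \<Longrightarrow> int (l i) dvd x"
  shows "(\<Prod>i\<in>I. int (l i)) dvd x"
proof -
  have "inj_on (\<lambda>i. int (l i)) I" using assms(2) by (auto simp: inj_on_def)
  hence "(\<Prod>i\<in>I. int (l i)) = \<Prod>((\<lambda>i. int (l i)) ` I)" by (simp add: prod.reindex)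
  also have "\<dots> dvd x"
    by (rule prod_primes_dvd) (use assms in auto)
  finally show ?thesis .
qed

lemma eq_of_cong_distinct_primes:
  fixes l :: "'i \<Rightarrow> nat" and s s' :: int
  assumes "finite I" "inj_on l I" "\<And>i. i \<in> I \<Longrightarrow> prime (l i)"
    and "\<And>i. i \<in> I \<Longrightarrow> [s = s'] (mod int (l i))"
    and "s \<in> {0..<\<Prod>i\<in>I. int (l i)}" "s' \<in> {0..<\<Prod>i\<in>I. int (l i)}"
  shows "s = s'"
proof -
  have "(\<Prod>i\<in>I. int (l i)) dvd s - s'"
    using assms(4) by (intro prod_distinct_primes_dvd assms(1-3)) (auto simp: cong_iff_dvd_diff)
  hence "[s = s'] (mod (\<Prod>i\<in>I. int (l i)))" by (simp add: cong_iff_dvd_diff)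
  thus ?thesis using assms(5,6) by (simp add: cong_def)
qed

text \<open>
  By the Chinese remainder theorem, an element of the sieve set is determined by its residues modulo the \<open>l\<^sub>i\<close>.
\<close>

lemma card_sieve_set_le:
  assumes "inj_on l {1..n}" "\<And>i. i \<in> {1..n} \<Longrightarrow> prime (l i)"
  shows "card (sieve_set N k n l a) \<le> (\<Prod>i=1..n. card (\<Union>j\<in>{1..k}. hyperbola_values (int (l i)) N (a i j)))"
proof -
  let ?U = "\<lambda>i. \<Union>j\<in>{1..k}. hyperbola_values (int (l i)) N (a i j)"
  let ?f = "\<lambda>s. \<lambda>i\<in>{1..n}. s mod int (l i)"
  have carrier: "carrier (residue_ring m) = {0..<m}" for m by (auto simp: residue_ring_def)
  have finU: "finite (?U i)" if "i \<in> {1..n}" for i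
  proof (rule finite_subset)
    show "?U i \<subseteq> {0..<int (l i)}"
      using hyperbola_values_discriminant(1)[OF assms(2)[OF that]] by blast
  qed simp
  have "card (sieve_set N k n l a) \<le> card (\<Pi>\<^sub>E i\<in>{1..n}. ?U i)"
  proof (rule card_inj_on_le)
    show "inj_on ?f (sieve_set N k n l a)"
    proof (rule inj_onI)
      fix s s' assume s: "s \<in> sieve_set N k n l a" "s' \<in> sieve_set N k n l a" and eq: "?f s = ?f s'"
      have "[s = s'] (mod int (l i))" if "i \<in> {1..n}" for i
        using fun_cong[OF eq, of i] that by (simp add: cong_def)
      thus "s = s'"
        using s by (intro eq_of_cong_distinct_primes[OF _ assms]) (auto simp: sieve_set_def carrier)
    qed
    show "?f ` sieve_set N k n l a \<subseteq> (\<Pi>\<^sub>E i\<in>{1..n}. ?U i)"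
      by (auto simp: sieve_set_def)
    show "finite (\<Pi>\<^sub>E i\<in>{1..n}. ?U i)" by (intro finite_PiE finU) auto
  qed
  also have "\<dots> = (\<Prod>i=1..n. card (?U i))" by (simp add: card_PiE)
  finally show ?thesis .
qed

text \<open>
  Take \<open>x = p\<close>: then \<open>N / x = q\<close>.
\<close>

lemma linear_form_in_hyperbola:
  fixes p q :: nat
  assumes l: "prime l" and pq: "\<not> l dvd p * q" and c: "[c = a] (mod int l)"
  shows "(c * int p + int q) mod int l \<in> hyperbola_values (int l) (int (p * q)) a"
proof -
  let ?R = "residue_ring (int l)"
  define x where "x = int p mod int l"
  have l0: "int l > 0" using prime_gt_0_nat[OF l] by simp
  have "\<not> int l dvd int p" using pq by (auto simp: dvd_mult2)
  hence "x \<noteq> 0" by (simp add: x_def dvd_eq_mod_eq_0)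
  moreover have "0 \<le> x" "x < int l" using l0 by (simp_all add: x_def)
  ultimately have x: "x \<in> Units ?R"
    unfolding Units_residue_ring_prime[OF l] by simp
  define y where "y = inv\<^bsub>?R\<^esub> x"
  have xp: "[x = int p] (mod int l)" by (simp add: x_def)
  have xy: "[x * y = 1] (mod int l)"
    unfolding y_def by (rule residue_ring_inverse[OF l x])
  have "[int p * y = x * y] (mod int l)"
    by (intro cong_mult cong_refl cong_sym[OF xp])
  hence py: "[int p * y = 1] (mod int l)" using xy by (rule cong_trans)
  have "[c * int p + int q * 1 = a * x + int q * (int p * y)] (mod int l)"
    by (intro cong_add cong_mult cong_refl c cong_sym[OF xp] cong_sym[OF py])
  hence "(c * int p + int q) mod int l = (a * x + int (p * q) * y) mod int l"
    by (simp add: cong_def mult_ac)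
  also have "\<dots> = (a \<otimes>\<^bsub>?R\<^esub> x) \<oplus>\<^bsub>?R\<^esub> ((int (p * q) mod int l) \<otimes>\<^bsub>?R\<^esub> inv\<^bsub>?R\<^esub> x)"
    unfolding y_def[symmetric] by (simp add: residue_ring_def mod_simps)
  finally show ?thesis unfolding hyperbola_values_def using x by blast
qed

lemma unit_residue_exists_unique:
  fixes l :: "nat \<Rightarrow> nat" and b :: "nat \<Rightarrow> int"
  assumes inj: "inj_on l {1..n}" and l: "\<And>i. i \<in> {1..n} \<Longrightarrow> prime (l i)"
    and b: "\<And>i. i \<in> {1..n} \<Longrightarrow> b i \<in> {1..int (l i) - 1}"
  shows "\<exists>!c. c \<in> unit_residues (int (\<Prod>i=1..n. l i)) \<and> (\<forall>i\<in>{1..n}. [c = b i] (mod int (l i)))"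
proof -
  let ?m = "\<Prod>i=1..n. l i"
  have mem: "c \<in> unit_residues (int ?m) \<longleftrightarrow> c \<in> {0..<int ?m} \<and> coprime c (int ?m)" for c
    by (auto simp: unit_residues_def residue_ring_def)
  have "\<forall>i\<in>{1..n}. \<forall>j\<in>{1..n}. i \<noteq> j \<longrightarrow> coprime (l i) (l j)"
    using inj l by (auto intro!: primes_coprime dest: inj_onD)
  moreover have "\<forall>i\<in>{1..n}. l i \<noteq> 0"
  proof
    show "l i \<noteq> 0" if "i \<in> {1..n}" for i using prime_gt_0_nat[OF l[OF that]] by simp
  qed
  ultimately obtain x where x: "x < ?m" "\<forall>i\<in>{1..n}. [x = nat (b i)] (mod l i)"
    using chinese_remainder_unique_nat[OF finite_atLeastAtMost, of 1 n l "\<lambda>i. nat (b i)"] by blast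
  have xb: "[int x = b i] (mod int (l i))" if "i \<in> {1..n}" for i
  proof -
    have "[int x = int (nat (b i))] (mod int (l i))"
      using x(2) that by (simp only: cong_int_iff)
    thus ?thesis using b[OF that] by simp
  qed
  have "coprime (int x) (int (l i))" if i: "i \<in> {1..n}" for i
  proof -
    have "\<not> int (l i) dvd b i" using b[OF i] by (auto dest: zdvd_imp_le)
    hence "\<not> int (l i) dvd int x" using cong_dvd_iff[OF xb[OF i]] by blast
    thus ?thesis using prime_imp_coprime[of "int (l i)" "int x"] l[OF i] by (simp add: coprime_commute)
  qed
  hence "coprime (int x) (int ?m)"
    unfolding of_nat_prod by (rule prod_coprime_right)
  moreover have "int x < int ?m" using x(1) by (rule of_nat_less_iff[THEN iffD2])
  ultimately have x_mem: "int x \<in> unit_residues (int ?m)" unfolding mem by simp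
  have m_eq: "int ?m = (\<Prod>i=1..n. int (l i))" by (rule of_nat_prod)
  show ?thesis
  proof (rule ex1I[of _ "int x"])
    show "int x \<in> unit_residues (int ?m) \<and> (\<forall>i\<in>{1..n}. [int x = b i] (mod int (l i)))"
      using x_mem xb by blast
    fix c assume c: "c \<in> unit_residues (int ?m) \<and> (\<forall>i\<in>{1..n}. [c = b i] (mod int (l i)))"
    show "c = int x"
    proof (rule eq_of_cong_distinct_primes[OF _ inj l])
      show "[c = int x] (mod int (l i))" if "i \<in> {1..n}" for i
        using c xb[OF that] that cong_sym cong_trans by blast
      show "c \<in> {0..<\<Prod>i = 1..n. int (l i)}"
        using c unfolding mem m_eq[symmetric] by blast
      show "int x \<in> {0..<\<Prod>i = 1..n. int (l i)}"
        using x_mem unfolding mem m_eq[symmetric] by blast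
    qed simp
  qed
qed

theorem corollary8p2:
  fixes p q k n :: nat and N :: nat and m :: nat and L :: real
    and l :: "nat \<Rightarrow> nat" and a :: "nat \<Rightarrow> nat \<Rightarrow> int"
  assumes "prime p" and "prime q" and "N = p * q"
    and "k \<ge> 1"
    and "L > 0"
    and "inj_on l {1..n}"
    and "\<And>i. i \<in> {1..n} \<Longrightarrow> prime (l i) \<and> odd (l i) \<and> real (l i) \<ge> L \<and> \<not> l i dvd N"
    and "m = (\<Prod>i=1..n. l i)"
    and "\<And>i j. i \<in> {1..n} \<Longrightarrow> j \<in> {1..k} \<Longrightarrow> a i j \<in> Units (residue_ring (int (l i)))"
    and "\<And>i. i \<in> {1..n} \<Longrightarrow> inj_on (a i) {1..k}"
  shows "real (card (sieve_set (int N) k n l a))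
           \<le> real m * (\<Prod>i=1..n. 1 - 1 / 2 ^ k + (real k - 1 + 1 / 2 ^ k) / sqrt (real (l i))
                                  + real k / real (l i))
       \<and> real m * (\<Prod>i=1..n. 1 - 1 / 2 ^ k + (real k - 1 + 1 / 2 ^ k) / sqrt (real (l i))
                                  + real k / real (l i))
           \<le> real m * (1 - 1 / 2 ^ k + (real k - 1 + 1 / 2 ^ k) / sqrt L + real k / L) ^ n
       \<and> (\<forall>j \<in> {1..n} \<rightarrow>\<^sub>E {1..k}.
            (\<exists>!c. c \<in> unit_residues (int m) \<and> (\<forall>i\<in>{1..n}. [c = a i (j i)] (mod int (l i)))) \<and>
            (\<forall>c. c \<in> unit_residues (int m) \<and> (\<forall>i\<in>{1..n}. [c = a i (j i)] (mod int (l i)))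
               \<longrightarrow> (c * int p + int q) mod int m \<in> sieve_set (int N) k n l a))"
proof -
  define F where "F = (\<lambda>x. 1 - 1 / 2 ^ k + (real k - 1 + 1 / 2 ^ k) / sqrt x + real k / x)"
  let ?U = "\<lambda>i. \<Union>j\<in>{1..k}. hyperbola_values (int (l i)) (int N) (a i j)"
  have l: "prime (l i)" "odd (l i)" "real (l i) \<ge> L" "\<not> l i dvd N" if "i \<in> {1..n}" for i
    using assms(7)[OF that] by blast+
  have F_nonneg: "0 \<le> F x" if "x > 0" for x
    using that assms(4) by (simp add: F_def)
  have F_mono: "F x \<le> F L" if "x \<ge> L" for x
    unfolding F_def using that assms(4,5) by (intro add_mono divide_left_mono order_refl) auto
  have m: "real m = (\<Prod>i=1..n. real (l i))"
    by (simp add: assms(8))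
  have part1: "real (card (sieve_set (int N) k n l a)) \<le> real m * (\<Prod>i=1..n. F (real (l i)))"
  proof -
    have "real (card (sieve_set (int N) k n l a)) \<le> real (\<Prod>i=1..n. card (?U i))"
      by (intro of_nat_mono card_sieve_set_le assms(6) l(1))
    also have "\<dots> = (\<Prod>i=1..n. real (card (?U i)))" by simp
    also have "\<dots> \<le> (\<Prod>i=1..n. real (l i) * F (real (l i)))"
    proof (rule prod_mono)
      fix i assume i: "i \<in> {1..n}"
      have "\<not> int (l i) dvd int N" using l(4)[OF i] by simp
      from card_hyperbola_union_le[OF l(1,2)[OF i] this assms(9)[OF i] assms(10)[OF i]]
      show "0 \<le> real (card (?U i)) \<and> real (card (?U i)) \<le> real (l i) * F (real (l i))"
        by (simp add: F_def)
    qed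
    finally show ?thesis by (simp add: m prod.distrib)
  qed
  have part2: "real m * (\<Prod>i=1..n. F (real (l i))) \<le> real m * F L ^ n"
  proof (rule mult_left_mono)
    have "(\<Prod>i=1..n. F (real (l i))) \<le> (\<Prod>i=1..n. F L)"
      by (rule prod_mono) (use l(3) assms(5) F_nonneg F_mono in \<open>auto intro: less_le_trans\<close>)
    thus "(\<Prod>i=1..n. F (real (l i))) \<le> F L ^ n" by simp
  qed simp
  have part3: "(\<exists>!c. c \<in> unit_residues (int m) \<and> (\<forall>i\<in>{1..n}. [c = a i (j i)] (mod int (l i)))) \<and>
            (\<forall>c. c \<in> unit_residues (int m) \<and> (\<forall>i\<in>{1..n}. [c = a i (j i)] (mod int (l i)))
               \<longrightarrow> (c * int p + int q) mod int m \<in> sieve_set (int N) k n l a)"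
    if j: "j \<in> {1..n} \<rightarrow>\<^sub>E {1..k}" for j
  proof (intro conjI allI impI)
    have jk: "j i \<in> {1..k}" if "i \<in> {1..n}" for i using j that by blast
    show "\<exists>!c. c \<in> unit_residues (int m) \<and> (\<forall>i\<in>{1..n}. [c = a i (j i)] (mod int (l i)))"
      unfolding assms(8)
    proof (rule unit_residue_exists_unique[OF assms(6) l(1)])
      show "a i (j i) \<in> {1..int (l i) - 1}" if i: "i \<in> {1..n}" for i
        using assms(9)[OF i jk[OF i]] unfolding Units_residue_ring_prime[OF l(1)[OF i]] .
    qed
    fix c assume c: "c \<in> unit_residues (int m) \<and> (\<forall>i\<in>{1..n}. [c = a i (j i)] (mod int (l i)))"
    have m0: "int m > 0"
      unfolding assms(8) of_nat_prod by (rule prod_pos) (simp add: l(1) prime_gt_0_nat)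
    have "(c * int p + int q) mod int m mod int (l i) \<in> ?U i" if i: "i \<in> {1..n}" for i
    proof -
      have "int (l i) dvd int m" unfolding assms(8) of_nat_prod by (rule dvd_prodI) (use i in auto)
      hence "(c * int p + int q) mod int m mod int (l i) = (c * int p + int q) mod int (l i)"
        by (rule mod_mod_cancel)
      moreover have "(c * int p + int q) mod int (l i) \<in> hyperbola_values (int (l i)) (int N) (a i (j i))"
        unfolding assms(3)
        by (rule linear_form_in_hyperbola) (use l[OF i] assms(3) c i in auto)
      ultimately show ?thesis using jk[OF i] by auto
    qed
    thus "(c * int p + int q) mod int m \<in> sieve_set (int N) k n l a"
      using m0 by (simp add: sieve_set_def residue_ring_def assms(8))
  qed
  show ?thesis
    by (rule conjI[OF part1[unfolded F_def] conjI[OF part2[unfolded F_def] ballI[OF part3]]])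
qed

end
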